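(* Let $N>2$ be an integer, $1<p<2$, $0\le b<\frac{N-p}{p}$ and $a=\frac{Nb}{N-p}$. There is a universal constant $C(N,p,b)>0$ (depending only on $N,p,b$) such that for all $u\in\mathcal{C}_0^\infty(\mathbb{R}^N\setminus\{\mathbf{0}\})$, $$\int_{\mathbb{R}^N}\frac{|\nabla u|^p}{|x|^{pb}}\,\mathrm{d}x+(p-1)\int_{\mathbb{R}^N}\frac{|u|^p}{|x|^{pa}}\,\mathrm{d}x-\left[N-(p-1)a-b-1\right]\int_{\mathbb{R}^N}\frac{|u|^p}{|x|^{(p-1)a+b+1}}\,\mathrm{d}x$$ $$\ge C(N,p,b)\inf_{c\in\mathbb{R}}\int_{\mathbb{R}^N}\frac{\left||u|^{\frac{p-2}{2}}u-|c|^{\frac{p-2}{2}}c\,e^{-\frac{\frac p2|x|^{b-a+1}}{b-a+1}}\right|^2}{|x|^{pa}}\,\mathrm{d}x.$$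
   Context: $\mathcal{C}_0^\infty(\mathbb{R}^N\setminus\{\mathbf{0}\})$ is the set of real-valued smooth functions compactly supported in $\mathbb{R}^N\setminus\{\mathbf{0}\}$. The expression $|s|^{\frac{p-2}{2}}s$ is understood to be $0$ when $s=0$. *)

theory Defs
  imports "HOL-Analysis.Analysis"
begin

definition partial_deriv :: "'n \<Rightarrow> (real ^ 'n \<Rightarrow> real) \<Rightarrow> real ^ 'n \<Rightarrow> real" where
  "partial_deriv i f x = frechet_derivative f (at x) (axis i 1)"

definition grad :: "(real ^ 'n \<Rightarrow> real) \<Rightarrow> real ^ 'n \<Rightarrow> real ^ 'n" where
  "grad f x = (\<chi> i. partial_deriv i f x)"

primrec Ck :: "nat \<Rightarrow> (real ^ 'n \<Rightarrow> real) \<Rightarrow> bool" where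
  "Ck 0 f \<longleftrightarrow> continuous_on UNIV f"
| "Ck (Suc k) f \<longleftrightarrow> f differentiable_on UNIV \<and> (\<forall>i. Ck k (partial_deriv i f))"

definition smooth :: "(real ^ 'n \<Rightarrow> real) \<Rightarrow> bool" where
  "smooth f \<longleftrightarrow> (\<forall>k. Ck k f)"

(* Functions with compact support in R^N - {0} are represented by their extensions by zero
   to all of R^N; smoothness on R^N - {0} and on R^N then agree, since the support is a
   closed set that does not contain the origin. *)
definition Cc_infty_punctured :: "(real ^ 'n \<Rightarrow> real) set" where
  "Cc_infty_punctured =
    {u. smooth u \<and> compact (closure (support_on UNIV u)) \<and> 0 \<notin> closure (support_on UNIV u)}"

(* The map s |-> |s|^((p-2)/2) s; the factor s makes its value at 0 equal to 0. *)
definition half_pow :: "real \<Rightarrow> real \<Rightarrow> real" where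
  "half_pow p s = \<bar>s\<bar> powr ((p - 2) / 2) * s"

end

theory Submission
  imports Defs
begin

text \<open>
  Put \<open>\<sigma> = b - a + 1\<close>, \<open>U = exp (- |x|\<^sup>\<sigma> / \<sigma>)\<close>, \<open>g = u / U\<close> and \<open>w = U powr p * |x| powr (- p a)\<close>. The divergence
  theorem turns the left-hand side into the integral of the Bregman remainder
  \<open>|A|\<^sup>p + (p - 1) |B|\<^sup>p + p |B| powr (p - 2) B \<bullet> A\<close> with \<open>A = |x| powr (- b) \<nabla>u\<close> and \<open>B = u |x| powr (- a) x / |x|\<close>.
  This remainder is at least a multiple of \<open>|A + B|\<^sup>2 (|B| + |A + B|) powr (p - 2)\<close>, and \<open>A + B\<close> equals
  \<open>|x| powr (- b) U \<nabla>g\<close>.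

  Since \<open>p < 2\<close>, the remainder controls \<open>|\<nabla>g|\<^sup>2\<close> only where the gradient is small compared with \<open>g\<close>, so a
  quadratic Poincare inequality does not suffice. Instead an \<open>L\<^sup>1\<close> inequality with weight \<open>w\<close> is
  applied to \<open>(m\<^sup>2 + (g - m)\<^sup>2) powr (p / 2) - |m| powr p\<close>, whose gradient is absorbed by the remainder in both
  regimes, and which dominates the square of the difference of the half powers of \<open>g\<close> and \<open>m\<close>. The
  \<open>L\<^sup>1\<close> inequality combines a radial vector field, which handles the origin and infinity, with the
  unweighted Poincare inequality on a cube; the constant \<open>m\<close> is chosen so that the signed version
  of the test function has mean zero on that cube.
\<close>

subsection \<open>Pointwise inequalities\<close>

text \<open>The exponents fit together because \<open>- b = - a + (1 - \<sigma>)\<close>. With z =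
  |x| powr (1 - \<sigma>) * |\<nabla>g|, the lengths of B and A + B are |g| and z times the common
  factor |x| powr (- a) * U, so the lower bound of the remainder becomes w z^2 (|g| + z) powr (p -
  2). The hypotheses on b give a - b = p b / (N - p) in [0, 1), hence 0 < \<sigma> \<le> 1, and p a
  < N, which makes w integrable.

  The estimate closes by absorption. Let X be the integral of the test function against w, Y that of
  the norm of its gradient against |x| powr (1 - \<sigma>) * w, and E the integral of the remainder.
  The radial field and the cube give X \<le> C Y; a pointwise Young-type bound gives Y \<le>
  \<delta> X + C' E for any \<delta> > 0, with C' depending on \<delta>. As X is finite, a small
  \<delta> yields a bound of X by E.

  The constant m need not be a minimiser, since any value of c bounds the infimum from above. It is
  dictated by the cube inequality, which needs mean zero. Attaching the sign of g - m to the test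
  function changes neither its modulus nor the length of its gradient, so the bound for the signed
  function serves the unsigned one.\<close>

lemma square_powr_half: "(x\<^sup>2) powr (q / 2) = \<bar>x\<bar> powr q" for x q :: real
proof -
  have "x\<^sup>2 = \<bar>x\<bar> powr 2" by (cases "x = 0") simp_all
  then show ?thesis by (simp only: powr_powr) simp
qed

text \<open>The second-derivative test gives concavity on the open half-line only; at a zero
  argument the claim reduces to \<open>r \<le> r powr q\<close> on [0, 1].\<close>

lemma powr_concave_comb:
  fixes q s X Y :: real
  assumes q: "0 < q" "q < 1" and s: "0 \<le> s" "s \<le> 1" and "0 \<le> X" "0 \<le> Y"
  shows "(1 - s) * X powr q + s * Y powr q \<le> ((1 - s) * X + s * Y) powr q"
proof -
  have self_le_powr: "r \<le> r powr q" if "0 \<le> r" "r \<le> 1" for r :: real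
    using powr_mono'[of q 1 r] that q by (cases "r = 0") auto
  consider "X = 0" | "Y = 0" | "X > 0" "Y > 0" using assms by linarith
  then show ?thesis
  proof cases
    case 1
    then show ?thesis using assms self_le_powr[OF s] by (simp add: powr_mult mult_right_mono)
  next
    case 2
    then show ?thesis using assms self_le_powr[of "1 - s"] by (simp add: powr_mult mult_right_mono)
  next
    case 3
    have "concave_on {0<..} (\<lambda>x::real. x powr q)"
    proof (rule f''_le0_imp_concave)
      fix x :: real assume "x \<in> {0<..}"
      then show "((\<lambda>x. x powr q) has_real_derivative q * x powr (q - 1)) (at x)"
        "((\<lambda>x. q * x powr (q - 1)) has_real_derivative q * ((q - 1) * x powr (q - 1 - 1))) (at x)"
        using q by (auto intro!: derivative_eq_intros)
      show "q * ((q - 1) * x powr (q - 1 - 1)) \<le> 0"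
        using q by (simp add: mult_nonneg_nonpos mult_nonpos_nonneg)
    qed simp
    from concave_onD[OF this, of s X Y] 3 s show ?thesis by simp
  qed
qed

text \<open>For \<open>z < 1\<close> this is Taylor expansion of \<open>x powr p\<close> at 1: the
  intermediate point is at most \<open>1 + \<bar>z\<bar>\<close>, and the exponent
  \<open>p - 2\<close> is negative. For \<open>z \<ge> 1\<close> the segment from 1 to
  \<open>1 - z\<close> meets the singularity at 0, so sizes are compared directly; this case
  produces the factor 1/4.\<close>

lemma bregman_powr_scalar:
  fixes p z :: real
  assumes p: "1 < p" "p < 2"
  shows "(p - 1) / 4 * (z\<^sup>2 * (1 + \<bar>z\<bar>) powr (p - 2)) \<le> \<bar>1 - z\<bar> powr p - 1 + p * z"
proof (cases "z < 1")
  case False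
  then have z: "1 \<le> z" by simp
  \<comment> \<open>\<open>M powr p\<close> is the larger of \<open>(z - 1) powr p\<close> and 1,
    the two sizes that the right-hand side controls because
    \<open>p * z - 1 \<ge> p - 1\<close>.\<close>
  define M where "M = max (z - 1) 1"
  have M: "1 \<le> M" "z \<le> 2 * M" using z by (auto simp: M_def max_def)
  have "z\<^sup>2 * (1 + \<bar>z\<bar>) powr (p - 2) \<le> z\<^sup>2 * z powr (p - 2)"
    using z p by (intro mult_left_mono powr_mono2') auto
  also have "\<dots> = z powr p" using z by (simp flip: powr_numeral powr_add)
  also have "\<dots> \<le> (2 * M) powr p" using M z p by (intro powr_mono2) auto
  also have "\<dots> = 2 powr p * M powr p" using M by (simp add: powr_mult)
  also have "\<dots> \<le> 4 * M powr p" using p powr_mono[of p 2 2] by (intro mult_right_mono) auto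
  finally have "(p - 1) / 4 * (z\<^sup>2 * (1 + \<bar>z\<bar>) powr (p - 2)) \<le> (p - 1) / 4 * (4 * M powr p)"
    using p by (intro mult_left_mono) auto
  also have "\<dots> = (p - 1) * M powr p" by simp
  also have "\<dots> \<le> (z - 1) powr p + (p - 1)"
  proof (cases "z - 1 \<le> 1")
    case True
    then show ?thesis using p by (simp add: M_def max_def)
  next
    case False
    have "(p - 1) * (z - 1) powr p \<le> 1 * (z - 1) powr p" using p by (intro mult_right_mono) auto
    then have "(p - 1) * (z - 1) powr p \<le> (z - 1) powr p + (p - 1)" using p by linarith
    then show ?thesis using False by (simp add: M_def max_def)
  qed
  also have "\<dots> \<le> \<bar>1 - z\<bar> powr p - 1 + p * z"
    using z p mult_left_mono[of 1 z p] by (simp add: abs_if)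
  finally show ?thesis .
next
  case True
  show ?thesis
  proof (cases "z = 0")
    case True then show ?thesis by simp
  next
    case nz: False
    define diff where "diff = (\<lambda>m::nat. if m = 0 then (\<lambda>x::real. x powr p) else if m = 1 then (\<lambda>x. p * x powr (p - 1))
        else (\<lambda>x. p * (p - 1) * x powr (p - 2)))"
    define lo hi where "lo = min 1 (1 - z)" and "hi = max 1 (1 - z)"
    have "\<exists>t. (if 1 - z < 1 then 1 - z < t \<and> t < 1 else 1 < t \<and> t < 1 - z) \<and>
      (1 - z) powr p = (\<Sum>m<2. diff m 1 / fact m * ((1 - z) - 1) ^ m) + diff 2 t / fact 2 * ((1 - z) - 1) ^ 2"
    proof (rule Taylor[where a=lo and b=hi])
      show "\<forall>m t. m < 2 \<and> lo \<le> t \<and> t \<le> hi \<longrightarrow> (diff m has_real_derivative diff (Suc m) t) (at t)"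
      proof (intro allI impI)
        fix m :: nat and t assume *: "m < 2 \<and> lo \<le> t \<and> t \<le> hi"
        then have t: "t > 0" using True by (auto simp: lo_def)
        have "m = 0 \<or> m = 1" using * by auto
        then show "(diff m has_real_derivative diff (Suc m) t) (at t)"
          using t unfolding diff_def by (auto intro!: derivative_eq_intros)
      qed
    qed (use nz in \<open>auto simp: diff_def lo_def hi_def\<close>)
    then obtain t where t: "if 1 - z < 1 then 1 - z < t \<and> t < 1 else 1 < t \<and> t < 1 - z"
      and eq: "(1 - z) powr p = 1 - p * z + p * (p - 1) / 2 * t powr (p - 2) * z\<^sup>2"
      by (auto simp: diff_def numeral_2_eq_2)
    have t': "0 < t" "t \<le> 1 + \<bar>z\<bar>" using t True by (auto split: if_splits)
    have "(p - 1) / 4 * (z\<^sup>2 * (1 + \<bar>z\<bar>) powr (p - 2)) \<le> p * (p - 1) / 2 * (z\<^sup>2 * t powr (p - 2))"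
      using p t' mult_left_mono[of "1 / 4" "p / 2" "p - 1"]
      by (intro mult_mono powr_mono2') (auto simp: mult.commute)
    then show ?thesis using eq True by (simp add: mult_ac)
  qed
qed

text \<open>With \<open>|B|\<close> and \<open>|A + B|\<close> fixed, the right-hand side is concave in \<open>B \<bullet> (A + B)\<close>, so only
  collinear vectors matter.\<close>

lemma bregman_powr_vector:
  fixes p :: real and A B :: "'a :: real_inner"
  assumes p: "1 < p" "p < 2"
  shows "(p - 1) / 4 * ((norm (A + B))\<^sup>2 * (norm B + norm (A + B)) powr (p - 2))
    \<le> norm A powr p + (p - 1) * norm B powr p + p * norm B powr (p - 2) * (B \<bullet> A)"
proof (cases "B = 0")
  case True
  have "(norm A)\<^sup>2 * norm A powr (p - 2) = norm A powr p"
    by (cases "A = 0") (simp_all flip: powr_numeral powr_add)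
  moreover have "(p - 1) / 4 * norm A powr p \<le> 1 * norm A powr p"
    using p by (intro mult_right_mono) auto
  ultimately show ?thesis using True by simp
next
  case False
  \<comment> \<open>Dividing by |B| leaves two parameters: the relative length z of A + B and its
    component y along B.\<close>
  define k where "k = norm B"
  define z where "z = norm (A + B) / k"
  define y where "y = (B \<bullet> (A + B)) / k\<^sup>2"
  have k: "k > 0" using False by (simp add: k_def)
  have z0: "z \<ge> 0" using k by (simp add: z_def)
  have yz: "\<bar>y\<bar> \<le> z"
    using Cauchy_Schwarz_ineq2[of B "A + B"] k
    by (simp add: y_def z_def k_def[symmetric] abs_mult power2_eq_square field_simps)
  have BA: "B \<bullet> A = k\<^sup>2 * (y - 1)"
    using k by (simp add: y_def field_simps inner_add_right k_def power2_norm_eq_inner)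
  have A2: "(norm A)\<^sup>2 = k\<^sup>2 * (1 - 2 * y + z\<^sup>2)"
  proof -
    have "(norm A)\<^sup>2 = (norm (A + B))\<^sup>2 - 2 * (B \<bullet> (A + B)) + k\<^sup>2"
      by (simp add: power2_norm_eq_inner k_def inner_simps inner_commute)
    then have "(norm A)\<^sup>2 = (k * z)\<^sup>2 - 2 * (k\<^sup>2 * y) + k\<^sup>2"
      using k by (simp add: y_def z_def)
    then show ?thesis by (simp add: algebra_simps)
  qed
  then have X0: "0 \<le> 1 - 2 * y + z\<^sup>2" using k by (metis zero_le_mult_iff zero_le_power2 not_le zero_less_power)
  have Ap: "norm A powr p = k powr p * (1 - 2 * y + z\<^sup>2) powr (p / 2)"
  proof -
    have "norm A powr p = ((norm A)\<^sup>2) powr (p / 2)"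
      by (simp flip: powr_numeral add: powr_powr)
    also have "\<dots> = (k\<^sup>2) powr (p / 2) * (1 - 2 * y + z\<^sup>2) powr (p / 2)"
      using X0 by (simp add: A2 powr_mult)
    also have "(k\<^sup>2) powr (p / 2) = k powr p" using k by (simp flip: powr_numeral add: powr_powr)
    finally show ?thesis .
  qed
  have scalar: "(p - 1) / 4 * (z\<^sup>2 * (1 + z) powr (p - 2)) \<le> (1 - 2 * y + z\<^sup>2) powr (p / 2) - 1 + p * y"
  proof (cases "z = 0")
    case True then show ?thesis using yz by simp
  next
    case False
    \<comment> \<open>The weight that writes y as a convex combination of the collinear values z and
      -z, at which the scalar inequality applies.\<close>
    define s where "s = (1 - y / z) / 2"
    have s: "0 \<le> s" "s \<le> 1" using yz z0 False by (auto simp: s_def field_simps)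
    have "2 * s = 1 - y / z" by (simp add: s_def)
    then have y: "y = (1 - 2 * s) * z" using False by simp
    let ?L = "(p - 1) / 4 * (z\<^sup>2 * (1 + z) powr (p - 2))"
    have 1: "?L \<le> \<bar>1 - z\<bar> powr p - 1 + p * z" and 2: "?L \<le> \<bar>1 + z\<bar> powr p - 1 - p * z"
      using bregman_powr_scalar[OF p, of z] bregman_powr_scalar[OF p, of "-z"] z0 by auto
    have "L = (1 - s) * L + s * L" for L :: real by (simp add: left_diff_distrib)
    then have "?L = (1 - s) * ?L + s * ?L" .
    also have "\<dots> \<le> (1 - s) * (\<bar>1 - z\<bar> powr p - 1 + p * z) + s * (\<bar>1 + z\<bar> powr p - 1 - p * z)"
      using s by (intro add_mono mult_left_mono 1 2) auto
    also have "\<dots> = (1 - s) * ((1 - z)\<^sup>2) powr (p/2) + s * ((1 + z)\<^sup>2) powr (p/2) - 1 + p * y"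
      by (simp add: square_powr_half y algebra_simps)
    also have "\<dots> \<le> ((1 - s) * (1 - z)\<^sup>2 + s * (1 + z)\<^sup>2) powr (p/2) - 1 + p * y"
      using powr_concave_comb[of "p/2" s "(1 - z)\<^sup>2" "(1 + z)\<^sup>2"] p s by simp
    also have "(1 - s) * (1 - z)\<^sup>2 + s * (1 + z)\<^sup>2 = 1 - 2 * y + z\<^sup>2"
      by (simp add: y power2_eq_square algebra_simps)
    finally show ?thesis .
  qed
  have e1: "(norm (A + B))\<^sup>2 * (norm B + norm (A + B)) powr (p - 2) = k powr p * (z\<^sup>2 * (1 + z) powr (p - 2))"
  proof -
    have n: "norm (A + B) = k * z" using k by (simp add: z_def)
    have "(k + k * z) powr (p - 2) = k powr (p - 2) * (1 + z) powr (p - 2)"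
      using k z0 by (simp add: powr_mult flip: distrib_left[of k 1 z, simplified])
    moreover have "k\<^sup>2 * k powr (p - 2) = k powr p" using k by (simp flip: powr_numeral powr_add)
    ultimately show ?thesis by (simp add: n k_def[symmetric] power_mult_distrib mult_ac)
  qed
  have e2: "k powr (p - 2) * (k\<^sup>2 * (y - 1)) = k powr p * (y - 1)"
    using k by (simp flip: powr_numeral powr_add mult.assoc)
  have "(p - 1) / 4 * ((norm (A + B))\<^sup>2 * (norm B + norm (A + B)) powr (p - 2))
    = k powr p * ((p - 1) / 4 * (z\<^sup>2 * (1 + z) powr (p - 2)))" unfolding e1 by simp
  also have "\<dots> \<le> k powr p * ((1 - 2 * y + z\<^sup>2) powr (p / 2) - 1 + p * y)"
    by (intro mult_left_mono scalar) auto
  also have "\<dots> = norm A powr p + (p - 1) * norm B powr p + p * norm B powr (p - 2) * (B \<bullet> A)"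
    unfolding BA Ap k_def[symmetric] mult.assoc e2 by (simp add: algebra_simps)
  finally show ?thesis .
qed

text \<open>Up to constants this is \<open>\<bar>m\<bar> powr (p - 2) * t\<^sup>2\<close> for \<open>\<bar>t\<bar> \<le> \<bar>m\<bar>\<close> and \<open>\<bar>t\<bar> powr p\<close> beyond: the two regimes
  of the Bregman remainder of \<open>\<bar>\<cdot>\<bar> powr p\<close>.\<close>

definition orlicz :: "real \<Rightarrow> real \<Rightarrow> real \<Rightarrow> real" where
  "orlicz p m t = (m\<^sup>2 + t\<^sup>2) powr (p / 2) - \<bar>m\<bar> powr p"

lemma orlicz_0 [simp]: "orlicz p m 0 = 0"
  by (simp add: orlicz_def square_powr_half)

lemma orlicz_zero_left: "orlicz p 0 t = \<bar>t\<bar> powr p"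
  by (simp add: orlicz_def square_powr_half)

text \<open>The chain rule breaks down only at m = t = 0, where the base of the power vanishes;
  there the difference quotient has modulus at most \<open>\<bar>h\<bar> powr (p - 1)\<close> and
  tends to 0 because \<open>1 < p\<close>.\<close>

lemma DERIV_orlicz:
  assumes "1 < p"
  shows "(orlicz p m has_real_derivative p * t * (m\<^sup>2 + t\<^sup>2) powr (p / 2 - 1)) (at t)"
proof (cases "m = 0 \<and> t = 0")
  case True
  have lim: "((\<lambda>h::real. \<bar>h\<bar> powr (p - 1)) \<longlongrightarrow> 0) (at 0)"
    by (rule tendsto_eq_rhs[OF tendsto_powr'[OF tendsto_rabs_zero[OF tendsto_ident_at] tendsto_const]])
      (use assms in auto)
  have "norm ((orlicz p 0 (0 + h) - orlicz p 0 0) / h) \<le> \<bar>h\<bar> powr (p - 1)" for h :: real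
    using powr_add[of "\<bar>h\<bar>" "p - 1" 1] by (cases "h = 0") (auto simp: orlicz_zero_left abs_mult)
  then have "\<forall>h. norm ((orlicz p 0 (0 + h) - orlicz p 0 0) / h) \<le> \<bar>h\<bar> powr (p - 1)"
    by blast
  then have "\<forall>\<^sub>F h in at 0. norm ((orlicz p 0 (0 + h) - orlicz p 0 0) / h) \<le> \<bar>h\<bar> powr (p - 1)"
    by simp
  then have "(orlicz p 0 has_real_derivative 0) (at 0)"
    unfolding DERIV_def by (rule Lim_null_comparison[OF _ lim])
  then show ?thesis using True by simp
next
  case False
  then have "m\<^sup>2 + t\<^sup>2 > 0" by (simp add: sum_power2_gt_zero_iff)
  then show ?thesis unfolding orlicz_def[abs_def] by (auto intro!: derivative_eq_intros)
qed

text \<open>By concavity the slope of \<open>x powr q\<close> is smallest at the right end X. The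
  mean value theorem is applied for \<open>0 < Y\<close>; for \<open>Y = 0\<close> the claim comes
  down to \<open>q < 1\<close>.\<close>

lemma powr_diff_ge_tangent:
  fixes X Y q :: real
  assumes "0 < q" "q < 1" "0 \<le> Y" "Y \<le> X"
  shows "q * (X - Y) * X powr (q - 1) \<le> X powr q - Y powr q"
proof -
  consider "X = Y" | "X > 0" "Y = 0" | "0 < Y" "Y < X" using assms by linarith
  then show ?thesis
  proof cases
    case 2
    then have "X * X powr (q - 1) = X powr q" by (simp add: powr_diff)
    moreover have "q * X powr q \<le> 1 * X powr q" using assms by (intro mult_right_mono) auto
    ultimately show ?thesis using 2 by (simp add: mult.assoc)
  next
    case 3
    have "\<exists>\<xi>>Y. \<xi> < X \<and> X powr q - Y powr q = (X - Y) * (q * \<xi> powr (q - 1))"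
      using 3 by (intro MVT2) (auto intro!: derivative_eq_intros)
    then obtain \<xi> where \<xi>: "Y < \<xi>" "\<xi> < X" "X powr q - Y powr q = (X - Y) * (q * \<xi> powr (q - 1))" by blast
    have "(X - Y) * (q * X powr (q - 1)) \<le> (X - Y) * (q * \<xi> powr (q - 1))"
      using \<xi> 3 assms by (intro mult_left_mono powr_mono2') auto
    then show ?thesis using \<xi> by (simp add: mult_ac)
  qed simp
qed

text \<open>The tangent inequality between \<open>m\<^sup>2\<close> and
  \<open>m\<^sup>2 + t\<^sup>2\<close>. It serves twice: to absorb the derivative of
  \<open>orlicz\<close>, and to dominate differences of half powers.\<close>

lemma orlicz_ge:
  assumes "1 < p" "p < 2"
  shows "p / 2 * (t\<^sup>2 * (m\<^sup>2 + t\<^sup>2) powr (p / 2 - 1)) \<le> orlicz p m t"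
  using powr_diff_ge_tangent[of "p/2" "m\<^sup>2" "m\<^sup>2 + t\<^sup>2"] assms
  by (simp add: orlicz_def square_powr_half mult.assoc)

lemma orlicz_nonneg: "0 < p \<Longrightarrow> 0 \<le> orlicz p m t"
  using powr_mono2[of "p/2" "m\<^sup>2" "m\<^sup>2 + t\<^sup>2"] by (simp add: orlicz_def square_powr_half)

text \<open>For \<open>z\<close> larger than \<open>M = sqrt (m\<^sup>2 + t\<^sup>2)\<close> the last term alone dominates;
  otherwise this is the arithmetic-geometric mean inequality.\<close>

lemma orlicz_deriv_mult_le:
  fixes p m t z \<epsilon> :: real
  assumes p: "1 < p" "p < 2" and z: "0 \<le> z" and \<epsilon>: "0 < \<epsilon>"
  shows "\<bar>t\<bar> * (m\<^sup>2 + t\<^sup>2) powr (p / 2 - 1) * z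
    \<le> \<epsilon> * (t\<^sup>2 * (m\<^sup>2 + t\<^sup>2) powr (p / 2 - 1)) + (3 + 1 / \<epsilon>) * (z\<^sup>2 * (\<bar>m + t\<bar> + z) powr (p - 2))"
proof -
  define M where "M = sqrt (m\<^sup>2 + t\<^sup>2)"
  have W: "(m\<^sup>2 + t\<^sup>2) powr (p / 2 - 1) = M powr (p - 2)"
    using square_powr_half[of M "p - 2"] by (simp add: M_def diff_divide_distrib)
  have M0: "M \<ge> 0" and tM: "\<bar>t\<bar> \<le> M" and mM: "\<bar>m\<bar> \<le> M"
    by (auto simp: M_def intro: real_le_rsqrt)
  \<comment> \<open>Both |m| and |t| are at most M, so \<open>\<bar>m + t\<bar> + z\<close> is at
    most three times the larger of M and z; as \<open>p - 2 > -1\<close>, this costs at most a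
    factor 3 after taking the power.\<close>
  have third: "(1::real) / 3 \<le> 3 powr (p - 2)" using powr_mono[of "-1" "p - 2" 3] p by (simp add: powr_minus_divide)
  let ?R = "z\<^sup>2 * (\<bar>m + t\<bar> + z) powr (p - 2)"
  have R0: "0 \<le> ?R" by simp
  consider "z = 0 \<or> M = 0" | "0 < z" "z \<le> M" | "0 < M" "M < z" using z M0 by linarith
  then show ?thesis
  proof cases
    case 1
    then show ?thesis using tM \<epsilon> R0 by (auto simp: W)
  next
    case 2
    have "M powr (p - 2) / 3 \<le> 3 powr (p - 2) * M powr (p - 2)"
      using mult_right_mono[OF third, of "M powr (p - 2)"] by simp
    also have "\<dots> = (3 * M) powr (p - 2)" using M0 by (simp add: powr_mult)
    also have "\<dots> \<le> (\<bar>m + t\<bar> + z) powr (p - 2)" using p 2 tM mM by (intro powr_mono2') auto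
    finally have *: "M powr (p - 2) \<le> 3 * (\<bar>m + t\<bar> + z) powr (p - 2)" by simp
    have "0 \<le> (2 * \<epsilon> * \<bar>t\<bar> - z)\<^sup>2" by simp
    then have "\<bar>t\<bar> * z * (4 * \<epsilon>) \<le> (\<epsilon> * t\<^sup>2 + z\<^sup>2 / (4 * \<epsilon>)) * (4 * \<epsilon>)"
      using \<epsilon> by (simp add: power2_eq_square algebra_simps)
    then have "\<bar>t\<bar> * z \<le> \<epsilon> * t\<^sup>2 + z\<^sup>2 / (4 * \<epsilon>)" using \<epsilon> by simp
    from mult_right_mono[OF this, of "M powr (p - 2)"]
    have "\<bar>t\<bar> * M powr (p - 2) * z \<le> \<epsilon> * (t\<^sup>2 * M powr (p - 2)) + z\<^sup>2 / (4 * \<epsilon>) * M powr (p - 2)"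
      by (simp add: algebra_simps)
    also have "z\<^sup>2 / (4 * \<epsilon>) * M powr (p - 2) \<le> z\<^sup>2 / (4 * \<epsilon>) * (3 * (\<bar>m + t\<bar> + z) powr (p - 2))"
      using \<epsilon> by (intro mult_left_mono *) auto
    also have "\<dots> = (3 / (4 * \<epsilon>)) * ?R" by simp
    also have "\<dots> \<le> (3 + 1 / \<epsilon>) * ?R" using \<epsilon> by (intro mult_right_mono R0) (simp add: field_simps)
    finally show ?thesis unfolding W by simp
  next
    case 3
    have "\<bar>t\<bar> * M powr (p - 2) * z \<le> M * M powr (p - 2) * z" using tM z by (intro mult_right_mono) auto
    also have "M * M powr (p - 2) = M powr (p - 1)" using 3 by (simp add: powr_diff power2_eq_square)
    also have "M powr (p - 1) * z \<le> z powr (p - 1) * z" using 3 p by (intro mult_right_mono powr_mono2) auto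
    also have "\<dots> = z\<^sup>2 * z powr (p - 2)" using 3 by (simp add: powr_diff power2_eq_square)
    also have "\<dots> \<le> z\<^sup>2 * (3 * (3 powr (p - 2) * z powr (p - 2)))"
      using third mult_right_mono[of 1 "3 * 3 powr (p - 2)" "z powr (p - 2)"]
      by (intro mult_left_mono) auto
    also have "3 powr (p - 2) * z powr (p - 2) = (3 * z) powr (p - 2)" using z by (simp add: powr_mult)
    also have "z\<^sup>2 * (3 * (3 * z) powr (p - 2)) \<le> z\<^sup>2 * (3 * (\<bar>m + t\<bar> + z) powr (p - 2))"
      using p 3 tM mM by (intro mult_left_mono powr_mono2') auto
    also have "\<dots> = 3 * ?R" by simp
    also have "\<dots> \<le> (3 + 1 / \<epsilon>) * ?R" using \<epsilon> by (intro mult_right_mono R0) simp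
    finally have "\<bar>t\<bar> * M powr (p - 2) * z \<le> (3 + 1 / \<epsilon>) * ?R" .
    moreover have "0 \<le> \<epsilon> * (t\<^sup>2 * M powr (p - 2))" using \<epsilon> by simp
    ultimately show ?thesis unfolding W by linarith
  qed
qed

section \<open>Differences of half powers\<close>

lemma half_pow_minus: "half_pow p (- s) = - half_pow p s"
  by (simp add: half_pow_def)

text \<open>The exponent is negative, so y carries the smaller factor. For x > 0, giving x that
  factor too only enlarges the difference. For x < 0 the moduli add up, each being at most
  \<open>y powr (p / 2)\<close>, which is where the factor 2 arises.\<close>

lemma half_pow_diff_le:
  assumes p: "p < 2" "0 < p" and "\<bar>x\<bar> \<le> y"
  shows "\<bar>half_pow p y - half_pow p x\<bar> \<le> 2 * \<bar>y - x\<bar> * y powr ((p - 2) / 2)"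
proof (cases "x = 0 \<or> y = 0")
  case True
  then show ?thesis using assms by (auto simp: half_pow_def abs_mult)
next
  case False
  then have y: "0 < y" and x: "0 < \<bar>x\<bar>" using assms by auto
  have le: "y powr ((p - 2) / 2) \<le> \<bar>x\<bar> powr ((p - 2) / 2)" using assms x by (intro powr_mono2') auto
  have eq: "\<bar>r\<bar> * \<bar>r\<bar> powr ((p - 2) / 2) = \<bar>r\<bar> powr (p / 2)" for r :: real
    by (cases "r = 0") (simp_all add: powr_diff diff_divide_distrib)
  have le2: "\<bar>x\<bar> * \<bar>x\<bar> powr ((p - 2) / 2) \<le> y * y powr ((p - 2) / 2)"
    using eq[of x] eq[of y] y assms by (simp add: powr_mono2)
  show ?thesis
  proof (cases "0 < x")
    case True
    have "x * y powr ((p - 2) / 2) \<le> x * x powr ((p - 2) / 2)" using True le by (intro mult_left_mono) auto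
    moreover have "x * y powr ((p - 2) / 2) \<le> y * y powr ((p - 2) / 2)"
      using assms by (intro mult_right_mono) auto
    ultimately have "x * (2 * y powr ((p - 2) / 2)) \<le> x * x powr ((p - 2) / 2) + y * y powr ((p - 2) / 2)"
      by linarith
    then show ?thesis using True y le2 assms(3) by (simp add: half_pow_def algebra_simps)
  next
    case F: False
    have "0 \<le> - x * y powr ((p - 2) / 2)" using F by (intro mult_nonneg_nonneg) auto
    moreover have "half_pow p y = y * y powr ((p - 2) / 2)" using y by (simp add: half_pow_def)
    moreover have "half_pow p x = - (\<bar>x\<bar> * \<bar>x\<bar> powr ((p - 2) / 2))" using F by (simp add: half_pow_def)
    moreover have "0 \<le> \<bar>x\<bar> * \<bar>x\<bar> powr ((p - 2) / 2)" by simp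
    moreover have "2 * \<bar>y - x\<bar> * y powr ((p - 2) / 2) = 2 * (y * y powr ((p - 2) / 2)) + 2 * (- x * y powr ((p - 2) / 2))"
      using F y by (simp add: left_diff_distrib)
    moreover have "0 \<le> y * y powr ((p - 2) / 2)" using y by simp
    ultimately show ?thesis using le2 by linarith
  qed
qed

text \<open>The preceding bound, squared, has K as base. Since |m| \<le> K and |t| \<le> 2 K, the
  root of \<open>m\<^sup>2 + t\<^sup>2\<close> is at most 3 K. Thus 36 = 4 * 9, with 9 bounding
  \<open>3 powr (2 - p)\<close>.\<close>

lemma half_pow_diff_square_le:
  fixes p m t :: real
  assumes p: "1 < p" "p < 2"
  shows "\<bar>half_pow p (m + t) - half_pow p m\<bar>\<^sup>2 \<le> 36 * (t\<^sup>2 * (m\<^sup>2 + t\<^sup>2) powr (p / 2 - 1))"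
proof -
  define K where "K = max \<bar>m + t\<bar> \<bar>m\<bar>"
  define M where "M = sqrt (m\<^sup>2 + t\<^sup>2)"
  have *: "\<bar>half_pow p y - half_pow p x\<bar> \<le> 2 * \<bar>y - x\<bar> * \<bar>y\<bar> powr ((p - 2) / 2)" if "\<bar>x\<bar> \<le> \<bar>y\<bar>" for x y
  proof (cases "y \<ge> 0")
    case True then show ?thesis using half_pow_diff_le[of p x y] that p by auto
  next
    case False
    then show ?thesis using half_pow_diff_le[of p "-x" "-y"] that p by (auto simp: half_pow_minus abs_minus_commute)
  qed
  have "\<bar>half_pow p (m + t) - half_pow p m\<bar> \<le> 2 * \<bar>t\<bar> * K powr ((p - 2) / 2)"
  proof (cases "\<bar>m\<bar> \<le> \<bar>m + t\<bar>")
    case True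
    then have "K = \<bar>m + t\<bar>" by (simp add: K_def)
    with *[OF True] show ?thesis by simp
  next
    case False
    then have "\<bar>m + t\<bar> \<le> \<bar>m\<bar>" "K = \<bar>m\<bar>" by (simp_all add: K_def)
    with *[of "m + t" m] show ?thesis by (simp add: abs_minus_commute)
  qed
  then have "\<bar>half_pow p (m + t) - half_pow p m\<bar>\<^sup>2 \<le> (2 * \<bar>t\<bar> * K powr ((p - 2) / 2))\<^sup>2"
    by (intro power_mono) auto
  also have "\<dots> = 4 * t\<^sup>2 * (K powr ((p - 2) / 2) * K powr ((p - 2) / 2))"
    by (simp add: power_mult_distrib power2_eq_square)
  also have "K powr ((p - 2) / 2) * K powr ((p - 2) / 2) = K powr (p - 2)"
    by (simp flip: powr_add)
  also have "4 * t\<^sup>2 * K powr (p - 2) \<le> 4 * t\<^sup>2 * (9 * M powr (p - 2))"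
  proof (cases "M = 0")
    case True
    then have "m = 0" "t = 0" by (auto simp: M_def sum_power2_eq_zero_iff)
    then show ?thesis by (simp add: K_def sum_power2_eq_zero_iff)
  next
    case False
    have "\<bar>m\<bar> \<le> K" "\<bar>m + t\<bar> \<le> K" by (auto simp: K_def)
    moreover from this have "\<bar>t\<bar> \<le> 2 * K" by linarith
    ultimately have mt: "\<bar>m\<bar> \<le> K" "\<bar>t\<bar> \<le> 2 * K" by auto
    have sq: "(2 * K)\<^sup>2 = 4 * K\<^sup>2" "(3 * K)\<^sup>2 = 9 * K\<^sup>2" by simp_all
    have "m\<^sup>2 \<le> K\<^sup>2" "t\<^sup>2 \<le> (2 * K)\<^sup>2" using mt abs_le_square_iff[of m K] abs_le_square_iff[of t "2*K"] by auto
    then have "m\<^sup>2 + t\<^sup>2 \<le> (3 * K)\<^sup>2"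
      using zero_le_power2[of K] sq by linarith
    moreover have "0 \<le> K" by (simp add: K_def)
    ultimately have "M \<le> 3 * K" unfolding M_def by (intro real_le_lsqrt) simp_all
    moreover have "0 < M" using False by (simp add: M_def less_le)
    ultimately have "(M / 3) powr (p - 2) \<ge> K powr (p - 2)" using p by (intro powr_mono2') auto
    moreover have "(M / 3) powr (p - 2) = 3 powr (2 - p) * M powr (p - 2)"
      using \<open>0 < M\<close> powr_minus_divide[of "3::real" "p - 2"] by (simp add: powr_divide)
    moreover have "(3::real) powr (2 - p) * M powr (p - 2) \<le> 9 * M powr (p - 2)"
      using powr_mono[of "2 - p" 2 "3::real"] p by (intro mult_right_mono) auto
    ultimately have "K powr (p - 2) \<le> 9 * M powr (p - 2)" by linarith
    then show ?thesis by (rule mult_left_mono) simp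
  qed
  also have "M powr (p - 2) = (m\<^sup>2 + t\<^sup>2) powr (p / 2 - 1)"
    using square_powr_half[of M "p - 2"] by (simp add: M_def diff_divide_distrib)
  finally show ?thesis by simp
qed

subsection \<open>Divergence theorem for radial fields\<close>

lemma lborel_translate:
  fixes f :: "'a::euclidean_space \<Rightarrow> real"
  assumes "integrable lborel f"
  shows integrable_lborel_translate: "integrable lborel (\<lambda>x. f (x + c))"
    and integral_lborel_translate: "(\<integral>x. f (x + c) \<partial>lborel) = (\<integral>x. f x \<partial>lborel)"
proof -
  have eq: "distr lborel borel (\<lambda>x. x + c) = (lborel :: 'a measure)"
  proof -
    have "(\<lambda>x. x + c) = (+) c" by (simp add: fun_eq_iff add.commute)
    then show ?thesis by (simp only: lborel_distr_plus)
  qed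
  have m: "f \<in> borel_measurable borel" using borel_measurable_integrable[OF assms] by simp
  show "integrable lborel (\<lambda>x. f (x + c))"
    using assms m by (subst (asm) eq[symmetric]) (simp add: integrable_distr_eq)
  show "(\<integral>x. f (x + c) \<partial>lborel) = (\<integral>x. f x \<partial>lborel)"
    using m by (subst (2) eq[symmetric]) (simp add: integral_distr)
qed

lemma AE_lborel_inner_Basis_nonzero:
  assumes "e \<in> Basis"
  shows "AE x in lborel. x \<bullet> e \<noteq> (0::real)"
proof -
  have "{x :: 'a. x \<bullet> e = 0} \<in> null_sets lebesgue"
    using negligible_standard_hyperplane[OF assms, of 0] by (simp add: negligible_iff_null_sets)
  moreover have "{x :: 'a. x \<bullet> e = 0} \<in> sets lborel" by simp
  ultimately have "{x :: 'a. x \<bullet> e = 0} \<in> null_sets lborel"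
    by (simp add: null_sets_completion_iff)
  from AE_not_in[OF this] show ?thesis by simp
qed

text \<open>The line through almost every point parallel to \<open>e\<close> avoids the origin, so the
  fundamental theorem of calculus turns \<open>f (x + e) - f x\<close> into an average of \<open>f'\<close>;
  its integral vanishes by translation invariance.\<close>

lemma integral_directional_derivative_eq_0:
  fixes f f' :: "'a::euclidean_space \<Rightarrow> real"
  assumes dim: "2 \<le> DIM('a)" and e: "e \<in> Basis"
    and f: "integrable lborel f" and f': "integrable lborel f'"
    and cont: "continuous_on (- {0}) f'"
    and deriv: "\<And>x. x \<noteq> 0 \<Longrightarrow> ((\<lambda>s. f (x + s *\<^sub>R e)) has_real_derivative f' x) (at 0)"
  shows "(\<integral>x. f' x \<partial>lborel) = 0"
proof -
  have [measurable]: "f' \<in> borel_measurable borel" using borel_measurable_integrable[OF f'] by simp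
  have "card (Basis - {e}) \<noteq> 0" using dim e by (simp add: card_Diff_singleton)
  \<comment> \<open>The dimension enters here: a line in direction e passes through the origin only
    if its points are orthogonal to \<open>e'\<close>, and these form a null set.\<close>
  then obtain e' where e': "e' \<in> Basis" "e' \<noteq> e" by (metis Diff_iff card.empty insertI1 all_not_in_conv)
  define H where "H = (\<lambda>(s::real) x. indicator {0..1} s * f' (x + s *\<^sub>R e))"
  have H: "integrable (lborel \<Otimes>\<^sub>M lborel) (case_prod H)"
  proof (rule lborel_pair.Fubini_integrable)
    show "case_prod H \<in> borel_measurable (lborel \<Otimes>\<^sub>M lborel)" unfolding H_def by measurable
    have "(\<integral>x. norm (case_prod H (s, x)) \<partial>lborel) = indicator {0..1} s * (\<integral>x. norm (f' x) \<partial>lborel)" for s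
      using integral_lborel_translate[OF integrable_norm[OF f'], of "s *\<^sub>R e"]
      by (simp add: H_def abs_mult)
    then show "integrable lborel (\<lambda>s. \<integral>x. norm (case_prod H (s, x)) \<partial>lborel)" by simp
    show "AE s in lborel. integrable lborel (\<lambda>x. case_prod H (s, x))"
      by (simp add: H_def integrable_lborel_translate[OF f'])
  qed
  have "(\<integral>s. H s x \<partial>lborel) = f (x + e) - f x" if x: "x \<bullet> e' \<noteq> 0" for x
  proof -
    have nz: "x + s *\<^sub>R e \<noteq> 0" for s
    proof
      assume "x + s *\<^sub>R e = 0"
      then have "(x + s *\<^sub>R e) \<bullet> e' = 0" by simp
      then show False using x e e' by (simp add: inner_simps inner_not_same_Basis)
    qed
    have d: "((\<lambda>s. f (x + s *\<^sub>R e)) has_real_derivative f' (x + s *\<^sub>R e)) (at s)" for s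
    proof -
      have "(\<lambda>h. f (x + s *\<^sub>R e + h *\<^sub>R e)) = (\<lambda>h. f (x + (h + s) *\<^sub>R e))"
        by (simp add: algebra_simps)
      with deriv[OF nz, of s] show ?thesis using DERIV_shift[of "\<lambda>s. f (x + s *\<^sub>R e)" "f' (x + s *\<^sub>R e)" 0 s] by simp
    qed
    have "continuous_on UNIV (\<lambda>s. f' (x + s *\<^sub>R e))"
      by (intro continuous_on_compose2[OF cont] continuous_intros) (use nz in auto)
    then have c: "isCont (\<lambda>s. f' (x + s *\<^sub>R e)) s" for s
      by (simp add: continuous_on_eq_continuous_at)
    have "(\<integral>s. f' (x + s *\<^sub>R e) * indicator {0..1} s \<partial>lborel) = f (x + 1 *\<^sub>R e) - f (x + 0 *\<^sub>R e)"
      by (rule integral_FTC_Icc_real[OF _ d c]) simp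
    then show ?thesis by (simp add: H_def mult.commute)
  qed
  with AE_lborel_inner_Basis_nonzero[OF e'(1)]
  have "AE x in lborel. (\<integral>s. H s x \<partial>lborel) = f (x + e) - f x" by auto
  then have "(\<integral>x. (\<integral>s. H s x \<partial>lborel) \<partial>lborel) = (\<integral>x. f (x + e) - f x \<partial>lborel)"
    using f integrable_lborel_translate[OF f, of e] borel_measurable_integrable[OF lborel_pair.integrable_snd[OF H]]
    by (intro integral_cong_AE) auto
  also have "\<dots> = 0" using f by (simp add: integrable_lborel_translate integral_lborel_translate)
  also have "(\<integral>x. (\<integral>s. H s x \<partial>lborel) \<partial>lborel) = (\<integral>s. (\<integral>x. H s x \<partial>lborel) \<partial>lborel)"
    by (rule lborel_pair.Fubini_integral[OF H])
  also have "\<dots> = (\<integral>s. indicator {0..1::real} s * (\<integral>x. f' x \<partial>lborel) \<partial>lborel)"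
    by (simp add: H_def integral_lborel_translate[OF f'])
  finally show ?thesis by simp
qed

lemma GDERIV_imp_line_DERIV:
  assumes "GDERIV f x :> D"
  shows "((\<lambda>s. f (x + s *\<^sub>R e)) has_real_derivative (D \<bullet> e)) (at 0)"
proof -
  have "((\<lambda>s. x + s *\<^sub>R e) has_derivative (\<lambda>s. s *\<^sub>R e)) (at (0::real))"
    by (auto intro!: derivative_eq_intros)
  moreover have "(f has_derivative (\<lambda>h. h \<bullet> D)) (at (x + 0 *\<^sub>R e))" using assms by (simp add: gderiv_def)
  ultimately have "((\<lambda>s. f (x + s *\<^sub>R e)) has_derivative (\<lambda>s. (s *\<^sub>R e) \<bullet> D)) (at 0)"
    using has_derivative_compose by blast
  moreover have "(\<lambda>s. (s *\<^sub>R e) \<bullet> D) = (*) (D \<bullet> e)" by (simp add: fun_eq_iff inner_commute)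
  ultimately show ?thesis by (simp add: has_field_derivative_def)
qed

lemma continuous_punctured_measurable:
  "continuous_on (- {0}) f \<Longrightarrow> f \<in> borel_measurable borel"
  for f :: "'a::euclidean_space \<Rightarrow> 'b::{euclidean_space}"
  by (rule borel_measurable_continuous_countable_exceptions[of "{0}"]) auto

text \<open>The integrand is the divergence of the field \<open>F x * th (norm x)\<close> times x,
  treated one coordinate at a time. The four integrability hypotheses stand in for compact support
  and allow a singularity at the origin; they dominate each coordinate through
  \<open>\<bar>x \<bullet> e\<bar> \<le> norm x\<close>.\<close>

lemma radial_divergence_integral:
  fixes F :: "'a::euclidean_space \<Rightarrow> real" and V :: "'a \<Rightarrow> 'a" and th th' :: "real \<Rightarrow> real"
  assumes dim: "2 \<le> DIM('a)"
    and F: "\<And>x. x \<noteq> 0 \<Longrightarrow> GDERIV F x :> V x" and V: "continuous_on (- {0}) V"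
    and th: "\<And>r. 0 < r \<Longrightarrow> (th has_real_derivative th' r) (at r)" and th': "continuous_on {0<..} th'"
    and int1: "integrable lborel (\<lambda>x. norm x * (F x * th (norm x)))"
    and int2: "integrable lborel (\<lambda>x. F x * th (norm x))"
    and int3: "integrable lborel (\<lambda>x. F x * (norm x * th' (norm x)))"
    and int4: "integrable lborel (\<lambda>x. norm x * (th (norm x) * norm (V x)))"
  shows "integrable lborel (\<lambda>x. th (norm x) * (x \<bullet> V x))"
    and "(\<integral>x. F x * (DIM('a) * th (norm x) + norm x * th' (norm x)) + th (norm x) * (x \<bullet> V x) \<partial>lborel) = 0"
proof -
  have contF: "continuous_on (- {0}) F"
    using F by (intro continuous_at_imp_continuous_on ballI has_derivative_continuous) (auto simp: gderiv_def)
  have "continuous_on {0<..} th"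
    using th by (intro continuous_at_imp_continuous_on ballI DERIV_isCont) auto
  then have contth: "continuous_on (- {0::'a}) (\<lambda>x. th (norm x))"
    by (rule continuous_on_compose2) (auto intro!: continuous_intros)
  have contth': "continuous_on (- {0::'a}) (\<lambda>x. th' (norm x))"
    by (rule continuous_on_compose2[OF th']) (auto intro!: continuous_intros)
  note [measurable] = continuous_punctured_measurable[OF contF] continuous_punctured_measurable[OF V]
    continuous_punctured_measurable[OF contth] continuous_punctured_measurable[OF contth']
  define f where "f e x = F x * th (norm x) * (x \<bullet> e)" for e x
  define f' where "f' e x = F x * th (norm x) + F x * (th' (norm x) * ((x \<bullet> e)\<^sup>2 / norm x))
    + th (norm x) * (x \<bullet> e) * (V x \<bullet> e)" for e x
  have i1: "integrable lborel (f e)" if e: "e \<in> Basis" for e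
  proof (rule Bochner_Integration.integrable_bound[OF int1])
    have "\<bar>F x\<bar> * (\<bar>th (norm x)\<bar> * \<bar>x \<bullet> e\<bar>) \<le> \<bar>F x\<bar> * (\<bar>th (norm x)\<bar> * norm x)" for x
      by (intro mult_left_mono Basis_le_norm[OF e]) auto
    then show "AE x in lborel. norm (f e x) \<le> norm (norm x * (F x * th (norm x)))"
      by (intro AE_I2) (simp add: f_def abs_mult mult_ac)
    show "f e \<in> borel_measurable lborel" unfolding f_def by simp
  qed
  have i2: "integrable lborel (\<lambda>x. F x * (th' (norm x) * ((x \<bullet> e)\<^sup>2 / norm x)))" if e: "e \<in> Basis" for e
  proof (rule Bochner_Integration.integrable_bound[OF int3])
    have "\<bar>(x \<bullet> e)\<^sup>2 / norm x\<bar> \<le> norm x" for x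
    proof (cases "x = 0")
      case False
      have "(x \<bullet> e)\<^sup>2 \<le> (norm x)\<^sup>2" using Basis_le_norm[OF e, of x] by (simp add: abs_le_square_iff[symmetric])
      then show ?thesis using False by (simp add: field_simps power2_eq_square)
    qed simp
    then have "\<bar>F x\<bar> * (\<bar>th' (norm x)\<bar> * \<bar>(x \<bullet> e)\<^sup>2 / norm x\<bar>) \<le> \<bar>F x\<bar> * (\<bar>th' (norm x)\<bar> * norm x)" for x
      by (intro mult_left_mono) auto
    then show "AE x in lborel. norm (F x * (th' (norm x) * ((x \<bullet> e)\<^sup>2 / norm x))) \<le> norm (F x * (norm x * th' (norm x)))"
      by (intro AE_I2) (simp add: abs_mult mult_ac)
  qed simp
  have i3: "integrable lborel (\<lambda>x. th (norm x) * (x \<bullet> e) * (V x \<bullet> e))" if e: "e \<in> Basis" for e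
  proof (rule Bochner_Integration.integrable_bound[OF int4])
    have "\<bar>th (norm x)\<bar> * (\<bar>x \<bullet> e\<bar> * \<bar>V x \<bullet> e\<bar>) \<le> \<bar>th (norm x)\<bar> * (norm x * norm (V x))" for x
      by (intro mult_left_mono mult_mono Basis_le_norm[OF e]) auto
    then show "AE x in lborel. norm (th (norm x) * (x \<bullet> e) * (V x \<bullet> e)) \<le> norm (norm x * (th (norm x) * norm (V x)))"
      by (intro AE_I2) (simp add: abs_mult mult_ac)
  qed simp
  have i': "integrable lborel (f' e)" if "e \<in> Basis" for e
    unfolding f'_def using int2 i2[OF that] i3[OF that] by simp
  have "(\<integral>x. f' e x \<partial>lborel) = 0" if e: "e \<in> Basis" for e
  proof (rule integral_directional_derivative_eq_0[OF dim e i1[OF e] i'[OF e]])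
    show "continuous_on (- {0}) (f' e)"
      unfolding f'_def using contF contth contth' V by (auto intro!: continuous_intros)
    fix x :: 'a assume x: "x \<noteq> 0"
    have a: "GDERIV (\<lambda>x. th (norm x)) x :> th' (norm x) *\<^sub>R sgn x"
      using GDERIV_DERIV_compose[OF GDERIV_norm[OF x] th] x by simp
    have b: "GDERIV (\<lambda>x. x \<bullet> e) x :> e" by (auto simp: gderiv_def intro!: derivative_eq_intros)
    have "GDERIV (f e) x :> (F x * th (norm x)) *\<^sub>R e + (x \<bullet> e) *\<^sub>R (F x *\<^sub>R th' (norm x) *\<^sub>R sgn x + th (norm x) *\<^sub>R V x)"
      unfolding f_def by (intro GDERIV_mult F x a b)
    from GDERIV_imp_line_DERIV[OF this, of e]
    show "((\<lambda>s. f e (x + s *\<^sub>R e)) has_real_derivative f' e x) (at 0)"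
      using e by (simp add: f'_def inner_simps sgn_div_norm power2_eq_square algebra_simps divide_inverse)
  qed
  then have "0 = (\<Sum>e\<in>Basis. \<integral>x. f' e x \<partial>lborel)" by simp
  also have "\<dots> = (\<integral>x. (\<Sum>e\<in>Basis. f' e x) \<partial>lborel)" by (rule Bochner_Integration.integral_sum[symmetric]) (rule i')
  finally have "(\<integral>x. (\<Sum>e\<in>Basis. f' e x) \<partial>lborel) = 0" by simp
  moreover have "(\<Sum>e\<in>Basis. f' e x) = F x * (DIM('a) * th (norm x) + norm x * th' (norm x)) + th (norm x) * (x \<bullet> V x)" for x
  proof -
    have "(\<Sum>e\<in>Basis. F x * (th' (norm x) * ((x \<bullet> e)\<^sup>2 / norm x))) = F x * (th' (norm x) * ((\<Sum>e\<in>Basis. (x \<bullet> e)\<^sup>2) / norm x))"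
      by (simp add: sum_distrib_left sum_divide_distrib)
    also have "(\<Sum>e\<in>Basis. (x \<bullet> e)\<^sup>2) = (norm x)\<^sup>2"
      by (simp only: power2_norm_eq_inner euclidean_inner[of x x]) (simp add: power2_eq_square)
    finally have 1: "(\<Sum>e\<in>Basis. F x * (th' (norm x) * ((x \<bullet> e)\<^sup>2 / norm x))) = F x * (norm x * th' (norm x))"
      by (simp add: power2_eq_square mult.commute)
    have 2: "(\<Sum>e\<in>Basis. th (norm x) * (x \<bullet> e) * (V x \<bullet> e)) = th (norm x) * (x \<bullet> V x)"
      by (simp add: euclidean_inner[of x "V x"] sum_distrib_left mult.assoc)
    show ?thesis unfolding f'_def sum.distrib 1 2 by (simp add: algebra_simps)
  qed
  ultimately show "(\<integral>x. F x * (DIM('a) * th (norm x) + norm x * th' (norm x)) + th (norm x) * (x \<bullet> V x) \<partial>lborel) = 0" by simp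
  have "integrable lborel (\<lambda>x. \<Sum>e\<in>Basis. th (norm x) * (x \<bullet> e) * (V x \<bullet> e))" using i3 by (intro Bochner_Integration.integrable_sum)
  then show "integrable lborel (\<lambda>x. th (norm x) * (x \<bullet> V x))"
    by (simp add: euclidean_inner[of _ "V _"] sum_distrib_left mult.assoc)
qed

subsection \<open>Weighted mean bounded by an unweighted cube mean\<close>

text \<open>Separate exponents at the origin and at infinity give one radial majorant that is
  integrable in dimension n for 0 \<le> \<alpha> < n < \<beta>.\<close>

definition two_powr :: "real \<Rightarrow> real \<Rightarrow> real \<Rightarrow> real" where
  "two_powr \<alpha> \<beta> t = (if t \<le> 1 then t powr - \<alpha> else t powr - \<beta>)"

lemma two_powr_nonneg [simp]: "0 \<le> two_powr \<alpha> \<beta> t"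
  by (simp add: two_powr_def)

lemma two_powr_measurable [measurable]: "two_powr \<alpha> \<beta> \<in> borel_measurable borel"
  unfolding two_powr_def[abs_def] by measurable

lemma two_powr_antimono:
  assumes "0 \<le> \<alpha>" "0 \<le> \<beta>" "0 < s" "s \<le> t"
  shows "two_powr \<alpha> \<beta> t \<le> two_powr \<alpha> \<beta> s"
proof -
  consider "t \<le> 1" | "1 < s" | "s \<le> 1" "1 < t" by linarith
  then show ?thesis
  proof cases
    case 1 then show ?thesis using assms by (simp add: two_powr_def powr_mono2')
  next
    case 2 then show ?thesis using assms by (simp add: two_powr_def powr_mono2')
  next
    case 3
    have "t powr - \<beta> \<le> 1 powr - \<beta>" using 3 assms by (intro powr_mono2') auto
    also have "\<dots> = 1 powr - \<alpha>" by simp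
    also have "\<dots> \<le> s powr - \<alpha>" using 3 assms by (intro powr_mono2') auto
    finally show ?thesis using 3 by (simp add: two_powr_def)
  qed
qed

lemma nn_integral_two_powr_abs_finite:
  assumes "\<alpha> < 1" "1 < \<beta>"
  shows "(\<integral>\<^sup>+t. ennreal (two_powr \<alpha> \<beta> \<bar>t\<bar>) \<partial>lborel) < \<infinity>"
proof -
  let ?f = "\<lambda>t. ennreal (two_powr \<alpha> \<beta> \<bar>t\<bar>)"
  have 1: "(\<integral>\<^sup>+t. ennreal (indicator {0..1} t * t powr - \<alpha>) \<partial>lborel) < \<infinity>"
    by (subst nn_integral_has_integral_lebesgue[OF _ has_integral_powr_from_0]) (use assms in auto)
  have 2: "(\<integral>\<^sup>+t. ennreal (indicator {1..} t * t powr - \<beta>) \<partial>lborel) < \<infinity>"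
    by (subst nn_integral_has_integral_lebesgue[OF _ has_integral_powr_to_inf]) (use assms in auto)
  have le: "indicator {0..} t * ?f t \<le> ennreal (indicator {0..1} t * t powr - \<alpha>) + ennreal (indicator {1..} t * t powr - \<beta>)" for t
    by (auto simp: two_powr_def split: split_indicator)
  have "(\<integral>\<^sup>+t. indicator {0..} t * ?f t \<partial>lborel)
    \<le> (\<integral>\<^sup>+t. ennreal (indicator {0..1} t * t powr - \<alpha>) + ennreal (indicator {1..} t * t powr - \<beta>) \<partial>lborel)"
    by (rule nn_integral_mono[OF le])
  also have "\<dots> < \<infinity>" using 1 2 by (subst nn_integral_add) auto
  finally have pos: "(\<integral>\<^sup>+t. indicator {0..} t * ?f t \<partial>lborel) < \<infinity>" .
  have "(\<integral>\<^sup>+t. ?f t \<partial>lborel) \<le> (\<integral>\<^sup>+t. indicator {0..} t * ?f t + indicator {0..} (- t) * ?f (- t) \<partial>lborel)"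
    by (intro nn_integral_mono) (auto split: split_indicator)
  also have "\<dots> = (\<integral>\<^sup>+t. indicator {0..} t * ?f t \<partial>lborel) + (\<integral>\<^sup>+t. indicator {0..} (- t) * ?f (- t) \<partial>lborel)"
    by (subst nn_integral_add) auto
  also have "(\<integral>\<^sup>+t. indicator {0..} (- t) * ?f (- t) \<partial>lborel) = (\<integral>\<^sup>+t. indicator {0..} t * ?f t \<partial>lborel)"
    by (subst (2) lborel_distr_uminus[symmetric], subst nn_integral_distr) auto
  finally show ?thesis using pos by (simp add: ennreal_add_less_top le_less_trans)
qed

text \<open>The radial function is dominated by a product of one-dimensional ones.\<close>

lemma integrable_two_powr_norm:
  fixes \<alpha> \<beta> :: real
  assumes "0 \<le> \<alpha>" "\<alpha> < DIM('a)" "DIM('a) < \<beta>"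
  shows "integrable lborel (\<lambda>x::'a::euclidean_space. two_powr \<alpha> \<beta> (norm x))"
proof (rule integrableI_nonneg)
  let ?n = "real DIM('a)"
  let ?g = "\<lambda>t. two_powr (\<alpha> / ?n) (\<beta> / ?n) \<bar>t\<bar>"
  \<comment> \<open>Every coordinate receives an equal share of both exponents; monotonicity and
    \<open>\<bar>x \<bullet> e\<bar> \<le> norm x\<close> then bound each factor.\<close>
  have power: "two_powr \<alpha> \<beta> r = two_powr (\<alpha> / ?n) (\<beta> / ?n) r ^ DIM('a)" if "0 < r" for r
    using that by (simp add: two_powr_def powr_power)
  \<comment> \<open>Because \<open>0 powr y = 0\<close>, the product vanishes and the bound fails at
    nonzero points having a zero coordinate.\<close>
  have "AE x::'a in lborel. \<forall>e\<in>Basis. x \<bullet> e \<noteq> 0"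
  proof (subst AE_ball_countable)
    show "\<forall>e\<in>Basis. AE x::'a in lborel. x \<bullet> e \<noteq> 0"
      by (simp add: AE_lborel_inner_Basis_nonzero)
  qed (simp add: countable_finite)
  then have ae: "AE x::'a in lborel. ennreal (two_powr \<alpha> \<beta> (norm x)) \<le> (\<Prod>e\<in>Basis. ennreal (?g (x \<bullet> e)))"
  proof eventually_elim
    case (elim x)
    have "x \<noteq> 0" using elim SOME_Basis by force
    then have "two_powr \<alpha> \<beta> (norm x) = (\<Prod>e\<in>(Basis::'a set). two_powr (\<alpha> / ?n) (\<beta> / ?n) (norm x))"
      by (simp add: power)
    also have "\<dots> \<le> (\<Prod>e\<in>Basis. ?g (x \<bullet> e))"
      using assms elim by (intro prod_mono conjI two_powr_antimono) (auto simp: Basis_le_norm)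
    finally show ?case by (simp add: prod_ennreal ennreal_leI)
  qed
  have "(\<integral>\<^sup>+x. ennreal (two_powr \<alpha> \<beta> (norm x)) \<partial>(lborel :: 'a measure)) \<le> (\<integral>\<^sup>+x. (\<Prod>e\<in>Basis. ennreal (?g (x \<bullet> e))) \<partial>(lborel :: 'a measure))"
    by (rule nn_integral_mono_AE[OF ae])
  also have "\<dots> = (\<Prod>e\<in>(Basis::'a set). \<integral>\<^sup>+t. ennreal (?g t) \<partial>lborel)"
    by (rule nn_integral_lborel_prod) auto
  also have "\<dots> < \<infinity>"
    using nn_integral_two_powr_abs_finite[of "\<alpha> / ?n" "\<beta> / ?n"] assms
    by (simp add: power_less_top_ennreal)
  finally show "(\<integral>\<^sup>+x. ennreal (two_powr \<alpha> \<beta> (norm x)) \<partial>(lborel :: 'a measure)) < \<infinity>" .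
qed auto

text \<open>For \<alpha> = p a and \<kappa> = p / \<sigma> this is the weight w of the overview as a
  function of the radius.\<close>

definition wt :: "real \<Rightarrow> real \<Rightarrow> real \<Rightarrow> real \<Rightarrow> real" where
  "wt \<alpha> \<kappa> \<sigma> r = r powr - \<alpha> * exp (- \<kappa> * r powr \<sigma>)"

lemma wt_nonneg [simp]: "0 \<le> wt \<alpha> \<kappa> \<sigma> r"
  by (simp add: wt_def)

lemma wt_measurable [measurable]: "wt \<alpha> \<kappa> \<sigma> \<in> borel_measurable borel"
  unfolding wt_def[abs_def] by measurable

text \<open>Follows from \<open>(1 + y / m) ^ m \<le> exp y\<close> once the integer m satisfies
  \<open>k \<le> \<sigma> * m\<close>.\<close>

lemma powr_mult_exp_bounded:
  fixes k \<kappa> \<sigma> :: real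
  assumes "0 < \<kappa>" "0 < \<sigma>"
  obtains C where "0 \<le> C" "\<And>r. 1 \<le> r \<Longrightarrow> r powr k * exp (- \<kappa> * r powr \<sigma>) \<le> C"
proof -
  obtain m0 :: nat where m0: "k / \<sigma> \<le> m0" using real_arch_simple by blast
  define m where "m = Suc m0"
  have m: "k \<le> \<sigma> * m" "0 < m" using m0 assms by (auto simp: m_def field_simps)
  show ?thesis
  proof (rule that[of "(m / \<kappa>) ^ m"])
    fix r :: real assume r: "1 \<le> r"
    define y where "y = r powr \<sigma>"
    have y: "0 \<le> y" by (simp add: y_def)
    have "r powr k \<le> r powr (\<sigma> * m)" using r m by (intro powr_mono) auto
    also have "\<dots> = y ^ m" using r by (simp add: y_def powr_power mult.commute)
    also have "\<dots> = (m / \<kappa>) ^ m * (\<kappa> * y / m) ^ m"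
      using m assms by (simp flip: power_mult_distrib)
    also have "(\<kappa> * y / m) ^ m \<le> (1 + \<kappa> * y / m) ^ m" using y assms by (intro power_mono) auto
    also have "\<dots> \<le> exp (\<kappa> * y)"
      using y assms m by (intro exp_ge_one_plus_x_over_n_power_n) (auto intro: order_trans[of _ 0])
    finally have "r powr k \<le> (m / \<kappa>) ^ m * exp (\<kappa> * y)" using assms by (simp add: mult_left_mono)
    then show "r powr k * exp (- \<kappa> * r powr \<sigma>) \<le> (m / \<kappa>) ^ m"
      by (simp add: y_def exp_minus field_simps)
  qed (use assms in simp)
qed

lemma wt_le_two_powr:
  fixes k :: real
  assumes "0 < \<kappa>" "0 < \<sigma>" "0 \<le> k" "0 \<le> \<alpha>"
  obtains C where "0 \<le> C" "\<And>r. 0 < r \<Longrightarrow> wt \<alpha> \<kappa> \<sigma> r \<le> C * two_powr \<alpha> k r"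
    "\<And>r. 0 < r \<Longrightarrow> r * wt \<alpha> \<kappa> \<sigma> r \<le> C * two_powr \<alpha> k r"
proof -
  \<comment> \<open>The extra power beyond k pays for the factor r in the last conclusion.\<close>
  obtain C where C: "0 \<le> C" "\<And>r. 1 \<le> r \<Longrightarrow> r powr (k + 1) * exp (- \<kappa> * r powr \<sigma>) \<le> C"
    using powr_mult_exp_bounded assms by metis
  have *: "max 1 r * wt \<alpha> \<kappa> \<sigma> r \<le> max 1 C * two_powr \<alpha> k r" if r: "0 < r" for r
  proof (cases "r \<le> 1")
    case True
    have "wt \<alpha> \<kappa> \<sigma> r \<le> r powr - \<alpha> * 1" unfolding wt_def using assms by (intro mult_left_mono) auto
    also have "\<dots> \<le> max 1 C * r powr - \<alpha>" using mult_right_mono[of 1 "max 1 C" "r powr - \<alpha>"] by simp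
    finally have "wt \<alpha> \<kappa> \<sigma> r \<le> max 1 C * r powr - \<alpha>" .
    moreover have "max 1 r = 1" using True by simp
    ultimately show ?thesis using True by (simp add: two_powr_def)
  next
    case False
    have "wt \<alpha> \<kappa> \<sigma> r \<le> 1 * exp (- \<kappa> * r powr \<sigma>)" unfolding wt_def
      using False assms powr_mono[of "- \<alpha>" 0 r] by (intro mult_right_mono) auto
    then have "r * wt \<alpha> \<kappa> \<sigma> r \<le> r * exp (- \<kappa> * r powr \<sigma>)" using r by simp
    also have "\<dots> = r powr - k * (r powr (k + 1) * exp (- \<kappa> * r powr \<sigma>))"
      using False by (simp add: powr_add powr_minus field_simps)
    also have "\<dots> \<le> r powr - k * C" using False by (intro mult_left_mono C) auto
    also have "\<dots> \<le> r powr - k * max 1 C" by (intro mult_left_mono) auto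
    finally show ?thesis using False by (simp add: two_powr_def mult.commute)
  qed
  show ?thesis
  proof (rule that[of "max 1 C"])
    fix r :: real assume r: "0 < r"
    have "wt \<alpha> \<kappa> \<sigma> r \<le> max 1 r * wt \<alpha> \<kappa> \<sigma> r" using mult_right_mono[of 1 "max 1 r" "wt \<alpha> \<kappa> \<sigma> r"] by simp
    with *[OF r] show "wt \<alpha> \<kappa> \<sigma> r \<le> max 1 C * two_powr \<alpha> k r" by linarith
    have "r * wt \<alpha> \<kappa> \<sigma> r \<le> max 1 r * wt \<alpha> \<kappa> \<sigma> r" by (intro mult_right_mono) auto
    with *[OF r] show "r * wt \<alpha> \<kappa> \<sigma> r \<le> max 1 C * two_powr \<alpha> k r" by linarith
  qed simp
qed

lemma integrable_wt:
  fixes \<alpha> \<kappa> \<sigma> :: real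
  assumes "0 < \<kappa>" "0 < \<sigma>" "0 \<le> \<alpha>" "\<alpha> < DIM('a::euclidean_space)"
  shows "integrable lborel (\<lambda>x::'a. wt \<alpha> \<kappa> \<sigma> (norm x))"
    and "integrable lborel (\<lambda>x::'a. norm x * wt \<alpha> \<kappa> \<sigma> (norm x))"
proof -
  obtain C where C: "0 \<le> C" "\<And>r. 0 < r \<Longrightarrow> wt \<alpha> \<kappa> \<sigma> r \<le> C * two_powr \<alpha> (DIM('a) + 1) r"
    "\<And>r. 0 < r \<Longrightarrow> r * wt \<alpha> \<kappa> \<sigma> r \<le> C * two_powr \<alpha> (DIM('a) + 1) r"
    by (rule wt_le_two_powr[of \<kappa> \<sigma> "DIM('a) + 1" \<alpha>]) (use assms in auto)
  have int: "integrable lborel (\<lambda>x::'a. C * two_powr \<alpha> (DIM('a) + 1) (norm x))"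
    using integrable_two_powr_norm[of \<alpha> "DIM('a) + 1", where 'a='a] assms by simp
  have ae: "AE x::'a in lborel. 0 < norm x" using AE_lborel_singleton[of "0::'a"] by simp
  have "AE x::'a in lborel. norm (wt \<alpha> \<kappa> \<sigma> (norm x)) \<le> norm (C * two_powr \<alpha> (DIM('a) + 1) (norm x))"
    using ae by eventually_elim (use C in \<open>simp add: abs_mult\<close>)
  then show "integrable lborel (\<lambda>x::'a. wt \<alpha> \<kappa> \<sigma> (norm x))"
    by (intro Bochner_Integration.integrable_bound[OF int]) auto
  have "AE x::'a in lborel. norm (norm x * wt \<alpha> \<kappa> \<sigma> (norm x)) \<le> norm (C * two_powr \<alpha> (DIM('a) + 1) (norm x))"
    using ae by eventually_elim (use C in \<open>simp add: abs_mult\<close>)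
  then show "integrable lborel (\<lambda>x::'a. norm x * wt \<alpha> \<kappa> \<sigma> (norm x))"
    by (intro Bochner_Integration.integrable_bound[OF int]) auto
qed

text \<open>\<open>div (w Q(|x|\<^sup>\<sigma>) x) = w P(|x|\<^sup>\<sigma>)\<close> for \<open>Q s = (1 - s) / (1 + s)\<^sup>2\<close>: this field points outwards
  near the origin and inwards near infinity, which makes \<open>P\<close> positive in both regions.\<close>

definition field_profile :: "real \<Rightarrow> real" where
  "field_profile s = (1 - s) / (1 + s)\<^sup>2"

definition field_profile' :: "real \<Rightarrow> real" where
  "field_profile' s = (s - 3) / (1 + s) ^ 3"

lemma DERIV_field_profile:
  "0 \<le> s \<Longrightarrow> (field_profile has_real_derivative field_profile' s) (at s)"
  unfolding field_profile_def[abs_def] field_profile'_def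
  by (auto intro!: derivative_eq_intros simp: divide_simps power2_eq_square power3_eq_cube) algebra

lemma abs_field_profile_le: "0 \<le> s \<Longrightarrow> \<bar>field_profile s\<bar> \<le> 1 / (1 + s)"
  by (auto simp: field_profile_def power2_eq_square abs_mult divide_simps)

lemma abs_mult_field_profile'_le: "0 \<le> s \<Longrightarrow> \<bar>s * field_profile' s\<bar> \<le> 3"
proof -
  assume s: "0 \<le> s"
  have "s * \<bar>s - 3\<bar> \<le> (1 + s) * (3 * (1 + s))" using s by (intro mult_mono) auto
  also have "\<dots> = 3 * (1 + s) ^ 2" by (simp add: power2_eq_square)
  also have "\<dots> \<le> 3 * (1 + s) ^ 3" using s power_increasing[of 2 3 "1 + s"] by simp
  finally show ?thesis using s by (simp add: field_profile'_def abs_mult pos_divide_le_eq)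
qed

text \<open>The right-hand side equals d at 0 and tends to k at infinity, where
  \<open>field_profile s\<close> behaves like -1/s against \<open>- k * s\<close> and the other
  terms die out. In between only boundedness on a compact interval is available, hence the
  indicator. In the application d is the dimension minus \<alpha>, and k = \<kappa>
  \<sigma>.\<close>

lemma field_divergence_lower_bound:
  fixes d k \<sigma> :: real
  assumes d: "0 < d" and k: "0 < k"
  obtains c C s1 s2 where "0 < c" "0 \<le> C" "0 < s1" "s1 \<le> s2"
    "\<And>s. 0 \<le> s \<Longrightarrow> c - C * indicator {s1..s2} s \<le> (d - k * s) * field_profile s + \<sigma> * (s * field_profile' s)"
proof -
  define P where "P s = (d - k * s) * field_profile s + \<sigma> * (s * field_profile' s)" for s
  have contP: "continuous_on {0..} P"
    unfolding P_def field_profile_def field_profile'_def by (auto intro!: continuous_intros)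
  have "(P \<longlongrightarrow> P 0) (at 0 within {0..})" using contP by (simp add: continuous_on_def)
  moreover have "P 0 = d" by (simp add: P_def field_profile_def)
  ultimately have "\<forall>\<^sub>F s in at 0 within {0..}. d / 2 < P s" using d by (intro order_tendstoD(1)) auto
  then obtain e where e: "0 < e" "\<And>s. s \<in> {0..} \<Longrightarrow> s \<noteq> 0 \<Longrightarrow> dist s 0 < e \<Longrightarrow> d / 2 < P s"
    unfolding eventually_at by blast
  define s1 where "s1 = e / 2"
  have s1: "0 < s1" and near0: "d / 2 \<le> P s" if "0 \<le> s" "s \<le> s1" for s
    using e(1) e(2)[of s] that d \<open>P 0 = d\<close> by (auto simp: s1_def dist_real_def) (cases "s = 0"; force)
  have s1: "0 < s1" using e(1) by (simp add: s1_def)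
  have A: "((\<lambda>s::real. s / (1 + s)) \<longlongrightarrow> 1) at_top"
  proof -
    have "((\<lambda>s::real. 1 - inverse (1 + s)) \<longlongrightarrow> 1 - 0) at_top"
      by (intro tendsto_intros tendsto_inverse_0_at_top filterlim_tendsto_add_at_top[OF tendsto_const] filterlim_ident)
    moreover have "\<forall>\<^sub>F s in at_top. 1 - inverse (1 + s) = s / (1 + s :: real)"
      using eventually_ge_at_top[of 0] by eventually_elim (simp add: field_simps)
    ultimately show ?thesis by (simp add: filterlim_cong)
  qed
  have D: "((\<lambda>s::real. 1 / (1 + s)) \<longlongrightarrow> 0) at_top"
    unfolding divide_inverse mult_1
    by (intro tendsto_inverse_0_at_top filterlim_tendsto_add_at_top[OF tendsto_const] filterlim_ident)
  have "((\<lambda>s. d * (1 / (1 + s)) * (1 / (1 + s) - s / (1 + s)) - k * (s / (1 + s)) * (1 / (1 + s) - s / (1 + s))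
    + \<sigma> * ((s / (1 + s)) * (s / (1 + s) - 3 * (1 / (1 + s))) * (1 / (1 + s)))) \<longlongrightarrow>
    d * 0 * (0 - 1) - k * 1 * (0 - 1) + \<sigma> * (1 * (1 - 3 * 0) * 0)) at_top"
    by (intro tendsto_intros A D)
  moreover have "\<forall>\<^sub>F s in at_top. d * (1 / (1 + s)) * (1 / (1 + s) - s / (1 + s)) - k * (s / (1 + s)) * (1 / (1 + s) - s / (1 + s))
    + \<sigma> * ((s / (1 + s)) * (s / (1 + s) - 3 * (1 / (1 + s))) * (1 / (1 + s))) = P s"
    using eventually_ge_at_top[of 0]
    by eventually_elim (simp add: P_def field_profile_def field_profile'_def divide_simps power2_eq_square power3_eq_cube, algebra)
  ultimately have "(P \<longlongrightarrow> k) at_top" by (simp add: filterlim_cong)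
  then have "\<forall>\<^sub>F s in at_top. k / 2 < P s" using k by (intro order_tendstoD(1)) auto
  then obtain s0 where s0: "\<And>s. s0 \<le> s \<Longrightarrow> k / 2 < P s" unfolding eventually_at_top_linorder by blast
  define s2 where "s2 = max s0 s1"
  have "compact (P ` {s1..s2})"
    using continuous_on_subset[OF contP, of "{s1..s2}"] s1 by (intro compact_continuous_image) auto
  then obtain M where M: "\<And>s. s \<in> {s1..s2} \<Longrightarrow> \<bar>P s\<bar> \<le> M"
    by (force dest!: compact_imp_bounded simp: bounded_iff)
  define c where "c = min (d / 2) (k / 2)"
  show ?thesis
  proof (rule that[of c "c + \<bar>M\<bar>" s1 s2])
    show "0 < c" "0 \<le> c + \<bar>M\<bar>" using d k by (auto simp: c_def)
    show "s1 \<le> s2" by (simp add: s2_def)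
    fix s :: real assume s: "0 \<le> s"
    consider "s \<in> {s1..s2}" | "s < s1" | "s2 < s" by fastforce
    then have "c - (c + \<bar>M\<bar>) * indicator {s1..s2} s \<le> P s"
    proof cases
      case 1 then show ?thesis using M[of s] by simp
    next
      case 2 then show ?thesis using near0[OF s] by (simp add: c_def)
    next
      case 3
      then have "indicator {s1..s2} s = (0::real)" by simp
      then show ?thesis using 3 s0[of s] by (simp add: c_def s2_def)
    qed
    then show "c - (c + \<bar>M\<bar>) * indicator {s1..s2} s \<le> (d - k * s) * field_profile s + \<sigma> * (s * field_profile' s)"
      by (simp add: P_def)
  qed (rule s1)
qed

text \<open>Integrating F against the divergence of the radial field leaves only the shell where
  that divergence may be negative, and the shell lies in a cube away from the singularity of the
  weight. The decay of \<open>field_profile\<close> like 1 / (1 + s) produces the gradient weight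
  \<open>norm x powr (1 - \<sigma>)\<close>. F is assumed bounded, not compactly supported, because
  the later test function is a constant, in general nonzero, wherever g vanishes.\<close>

lemma weighted_L1_bound:
  fixes \<alpha> \<kappa> \<sigma> :: real
  assumes dim: "2 \<le> DIM('a::euclidean_space)" and \<sigma>: "0 < \<sigma>" "\<sigma> \<le> 1" and \<kappa>: "0 < \<kappa>"
    and \<alpha>: "0 \<le> \<alpha>" "\<alpha> < DIM('a)"
  obtains C R where "0 < C" "0 < R"
    "\<And>(F::'a \<Rightarrow> real) V B L. (\<And>x. GDERIV F x :> V x) \<Longrightarrow> continuous_on UNIV V \<Longrightarrow>
      (\<And>x. 0 \<le> F x \<and> F x \<le> B) \<Longrightarrow> (\<And>x. L < norm x \<Longrightarrow> V x = 0) \<Longrightarrow>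
      integrable lborel (\<lambda>x. norm x powr (1 - \<sigma>) * wt \<alpha> \<kappa> \<sigma> (norm x) * norm (V x)) \<and>
      (\<integral>x. F x * wt \<alpha> \<kappa> \<sigma> (norm x) \<partial>lborel) \<le>
        C * ((\<integral>x. indicator (cbox (- R *\<^sub>R One) (R *\<^sub>R One)) x * F x \<partial>lborel)
          + (\<integral>x. norm x powr (1 - \<sigma>) * wt \<alpha> \<kappa> \<sigma> (norm x) * norm (V x) \<partial>lborel))"
proof -
  let ?n = "real DIM('a)"
  obtain c C s1 s2 where c: "0 < c" "0 \<le> C" "0 < s1" "s1 \<le> s2"
    and P: "\<And>s. 0 \<le> s \<Longrightarrow> c - C * indicator {s1..s2} s \<le> (?n - \<alpha> - \<kappa> * \<sigma> * s) * field_profile s + \<sigma> * (s * field_profile' s)"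
    using field_divergence_lower_bound[of "?n - \<alpha>" "\<kappa> * \<sigma>" \<sigma>] \<alpha> \<kappa> \<sigma> by (metis diff_gt_0_iff_gt mult_pos_pos)
  \<comment> \<open>The interval {s1..s2} for s = |x| powr \<sigma> is a shell of radii: R is its
    outer radius, and W bounds the weight at its inner radius, hence on the whole shell.\<close>
  define R where "R = s2 powr (1 / \<sigma>)"
  define W where "W = (s1 powr (1 / \<sigma>)) powr - \<alpha>"
  have R: "0 < R" using c by (simp add: R_def)
  let ?Q = "cbox (- R *\<^sub>R One) (R *\<^sub>R One) :: 'a set"
  let ?w = "wt \<alpha> \<kappa> \<sigma>"
  define th where "th r = ?w r * field_profile (r powr \<sigma>)" for r
  define th' where "th' r = ?w r / r * ((- \<alpha> - \<kappa> * \<sigma> * r powr \<sigma>) * field_profile (r powr \<sigma>)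
    + \<sigma> * (r powr \<sigma> * field_profile' (r powr \<sigma>)))" for r
  have DERIV_th: "(th has_real_derivative th' r) (at r)" if r: "0 < r" for r
  proof -
    have ds: "((\<lambda>r. r powr \<sigma>) has_real_derivative \<sigma> * r powr \<sigma> / r) (at r)"
      using r by (auto intro!: derivative_eq_intros simp: powr_diff)
    have "(?w has_real_derivative - \<alpha> * r powr (- \<alpha> - 1) * exp (- \<kappa> * r powr \<sigma>)
      + r powr - \<alpha> * (exp (- \<kappa> * r powr \<sigma>) * (- \<kappa> * (\<sigma> * r powr \<sigma> / r)))) (at r)"
      unfolding wt_def[abs_def] using r by (auto intro!: derivative_eq_intros simp: powr_diff field_simps)
    then have dw: "(?w has_real_derivative ?w r / r * (- \<alpha> - \<kappa> * \<sigma> * r powr \<sigma>)) (at r)"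
      by (rule DERIV_cong) (use r in \<open>simp add: wt_def powr_diff field_simps\<close>)
    have "(th has_real_derivative ?w r / r * (- \<alpha> - \<kappa> * \<sigma> * r powr \<sigma>) * field_profile (r powr \<sigma>)
      + field_profile' (r powr \<sigma>) * (\<sigma> * r powr \<sigma> / r) * ?w r) (at r)"
      unfolding th_def by (rule DERIV_mult[OF dw DERIV_chain2[OF DERIV_field_profile ds]]) simp
    then show ?thesis by (rule DERIV_cong) (use r in \<open>simp add: th'_def field_simps\<close>)
  qed
  have contth': "continuous_on {0<..} th'"
    unfolding th'_def wt_def field_profile_def field_profile'_def
    by (auto intro!: continuous_intros simp: add_pos_nonneg[THEN less_imp_neq, symmetric])
  have contth: "continuous_on {0<..} th"
    using DERIV_th by (intro continuous_at_imp_continuous_on ballI DERIV_isCont) auto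
  have th_le: "\<bar>th r\<bar> \<le> ?w r" for r
  proof -
    have "\<bar>th r\<bar> \<le> ?w r * (1 / (1 + r powr \<sigma>))"
      unfolding th_def abs_mult abs_of_nonneg[OF wt_nonneg]
      by (intro mult_left_mono abs_field_profile_le) auto
    also have "\<dots> \<le> ?w r * 1" by (intro mult_left_mono) (auto simp: divide_simps add_pos_nonneg)
    finally show ?thesis by simp
  qed
  have th_le': "r * \<bar>th r\<bar> \<le> r powr (1 - \<sigma>) * ?w r" if r: "0 \<le> r" for r
  proof (cases "r = 0")
    case False
    have "r * \<bar>th r\<bar> \<le> r * (?w r * (1 / (1 + r powr \<sigma>)))"
      unfolding th_def abs_mult abs_of_nonneg[OF wt_nonneg]
      using r by (intro mult_left_mono abs_field_profile_le) auto
    also have "\<dots> \<le> r * (?w r * (1 / r powr \<sigma>))" using r False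
      by (intro mult_left_mono divide_left_mono) (auto simp: add_pos_nonneg)
    also have "\<dots> = r powr (1 - \<sigma>) * ?w r" using r False by (simp add: powr_diff)
    finally show ?thesis .
  qed simp
  have th'_le: "\<bar>r * th' r\<bar> \<le> ?w r * (\<alpha> + \<kappa> * \<sigma> + 3 * \<sigma>)" if r: "0 \<le> r" for r
  proof (cases "r = 0")
    case False
    define s where "s = r powr \<sigma>"
    have s: "0 \<le> s" by (simp add: s_def)
    have "\<bar>(- \<alpha> - \<kappa> * \<sigma> * s) * field_profile s\<bar> \<le> (\<alpha> + \<kappa> * \<sigma> * s) * (1 / (1 + s))"
    proof (unfold abs_mult, intro mult_mono abs_field_profile_le s)
      have "0 \<le> \<kappa> * \<sigma> * s" using \<kappa> \<sigma> s by simp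
      then show "\<bar>- \<alpha> - \<kappa> * \<sigma> * s\<bar> \<le> \<alpha> + \<kappa> * \<sigma> * s" "0 \<le> \<alpha> + \<kappa> * \<sigma> * s" using \<alpha> by linarith+
    qed auto
    also have "\<dots> \<le> \<alpha> + \<kappa> * \<sigma>" 
    proof -
      have "0 \<le> \<alpha> * s + \<kappa> * \<sigma>" using \<alpha> \<kappa> \<sigma> s by simp
      then have "\<alpha> + \<kappa> * \<sigma> * s \<le> (\<alpha> + \<kappa> * \<sigma>) * (1 + s)" by (simp add: algebra_simps)
      then show ?thesis using s by (simp add: pos_divide_le_eq)
    qed
    finally have "\<bar>(- \<alpha> - \<kappa> * \<sigma> * s) * field_profile s\<bar> \<le> \<alpha> + \<kappa> * \<sigma>" .
    moreover have "\<bar>\<sigma> * (s * field_profile' s)\<bar> \<le> 3 * \<sigma>"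
      using mult_left_mono[OF abs_mult_field_profile'_le[OF s], of \<sigma>] \<sigma> by (simp add: abs_mult)
    ultimately have "\<bar>(- \<alpha> - \<kappa> * \<sigma> * s) * field_profile s + \<sigma> * (s * field_profile' s)\<bar> \<le> \<alpha> + \<kappa> * \<sigma> + 3 * \<sigma>"
      by linarith
    then have "?w r * \<bar>(- \<alpha> - \<kappa> * \<sigma> * s) * field_profile s + \<sigma> * (s * field_profile' s)\<bar> \<le> ?w r * (\<alpha> + \<kappa> * \<sigma> + 3 * \<sigma>)"
      by (intro mult_left_mono) auto
    then show ?thesis using False by (simp add: th'_def abs_mult s_def)
  qed (use \<alpha> \<kappa> \<sigma> in simp)
  have div: "?n * th r + r * th' r = ?w r * ((?n - \<alpha> - \<kappa> * \<sigma> * r powr \<sigma>) * field_profile (r powr \<sigma>)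
    + \<sigma> * (r powr \<sigma> * field_profile' (r powr \<sigma>)))" if "0 < r" for r
    using that by (simp add: th_def th'_def algebra_simps)
  note iw = integrable_wt[OF \<kappa> \<sigma>(1) \<alpha>]
  \<comment> \<open>One constant for the cube term, with factor C W, and the gradient term, with
    factor 1, after division by c.\<close>
  define K where "K = max 1 (C * W) / c"
  show ?thesis
  proof (rule that[of K R])
    show "0 < K" using c by (simp add: K_def)
    show "0 < R" by fact
    fix F :: "'a \<Rightarrow> real" and V :: "'a \<Rightarrow> 'a" and B L :: real
    assume F: "\<And>x. GDERIV F x :> V x" and V: "continuous_on UNIV V"
      and B: "\<And>x. 0 \<le> F x \<and> F x \<le> B" and L: "\<And>x. L < norm x \<Longrightarrow> V x = 0"
    have contF: "continuous_on UNIV F"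
      using F by (intro continuous_at_imp_continuous_on ballI has_derivative_continuous) (auto simp: gderiv_def)
    have contthn: "continuous_on (- {0::'a}) (\<lambda>x. th (norm x))"
      by (rule continuous_on_compose2[OF contth]) (auto intro!: continuous_intros)
    have contthn': "continuous_on (- {0::'a}) (\<lambda>x. th' (norm x))"
      by (rule continuous_on_compose2[OF contth']) (auto intro!: continuous_intros)
    note [measurable] = continuous_punctured_measurable[OF contthn] continuous_punctured_measurable[OF contthn']
      borel_measurable_continuous_onI[OF contF] borel_measurable_continuous_onI[OF V]
    obtain M where M: "\<And>x. norm (V x) \<le> M"
    proof -
      have "compact (V ` cball 0 L)" using continuous_on_subset[OF V] by (intro compact_continuous_image) auto
      then obtain M where "\<And>x. x \<in> cball 0 L \<Longrightarrow> norm (V x) \<le> M"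
        by (force dest!: compact_imp_bounded simp: bounded_iff)
      then have "norm (V x) \<le> max 0 M" for x
        using L[of x] by (cases "L < norm x") (simp_all add: le_max_iff_disj)
      then show ?thesis using that by blast
    qed
    have M0: "0 \<le> M" using M[of 0] norm_ge_zero order_trans by blast
    have B0: "0 \<le> B" using B[of 0] by linarith
    have i1: "integrable lborel (\<lambda>x. norm x * (F x * th (norm x)))"
    proof (rule Bochner_Integration.integrable_bound[OF integrable_mult_right[OF iw(2), of B]])
      have "F x * (norm x * \<bar>th (norm x)\<bar>) \<le> B * (norm x * ?w (norm x))" for x
        using B[of x] th_le B0 by (intro mult_mono) auto
      then show "AE x in lborel. norm (norm x * (F x * th (norm x))) \<le> norm (B * (norm x * ?w (norm x)))"
        using B B0 by (intro AE_I2) (simp add: abs_mult mult_ac)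
    qed simp
    have i2: "integrable lborel (\<lambda>x. F x * th (norm x))"
    proof (rule Bochner_Integration.integrable_bound[OF integrable_mult_right[OF iw(1), of B]])
      have "F x * \<bar>th (norm x)\<bar> \<le> B * ?w (norm x)" for x
        using B[of x] th_le B0 by (intro mult_mono) auto
      then show "AE x in lborel. norm (F x * th (norm x)) \<le> norm (B * ?w (norm x))"
        using B B0 by (intro AE_I2) (simp add: abs_mult)
    qed simp
    have i3: "integrable lborel (\<lambda>x. F x * (norm x * th' (norm x)))"
    proof (rule Bochner_Integration.integrable_bound[OF integrable_mult_right[OF iw(1), of "B * (\<alpha> + \<kappa> * \<sigma> + 3 * \<sigma>)"]])
      have "F x * \<bar>norm x * th' (norm x)\<bar> \<le> B * (?w (norm x) * (\<alpha> + \<kappa> * \<sigma> + 3 * \<sigma>))" for x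
        using B[of x] th'_le B0 by (intro mult_mono) auto
      then show "AE x in lborel. norm (F x * (norm x * th' (norm x))) \<le> norm (B * (\<alpha> + \<kappa> * \<sigma> + 3 * \<sigma>) * ?w (norm x))"
        using B B0 \<alpha> \<kappa> \<sigma> by (intro AE_I2) (simp add: abs_mult mult_ac)
    qed simp
    have i4: "integrable lborel (\<lambda>x. norm x * (th (norm x) * norm (V x)))"
    proof (rule Bochner_Integration.integrable_bound[OF integrable_mult_right[OF iw(2), of M]])
      have "norm (V x) * (norm x * \<bar>th (norm x)\<bar>) \<le> M * (norm x * ?w (norm x))" for x
        using M[of x] M0 th_le by (intro mult_mono) auto
      then show "AE x in lborel. norm (norm x * (th (norm x) * norm (V x))) \<le> norm (M * (norm x * ?w (norm x)))"
        using M0 by (intro AE_I2) (simp add: abs_mult mult_ac)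
    qed simp
    have iV: "integrable lborel (\<lambda>x. norm x powr (1 - \<sigma>) * ?w (norm x) * norm (V x))"
    proof (rule Bochner_Integration.integrable_bound[OF integrable_mult_right[OF Bochner_Integration.integrable_add[OF iw], of M]])
      have "norm x powr (1 - \<sigma>) * ?w (norm x) * norm (V x) \<le> (1 + norm x) * ?w (norm x) * M" for x :: 'a
      proof (intro mult_mono M M0)
        have "r powr (1 - \<sigma>) \<le> 1 + r" if "0 \<le> r" for r :: real
        proof (cases "r \<le> 1")
          case True
          then show ?thesis using powr_mono2[of "1 - \<sigma>" r 1] \<sigma> that by simp
        next
          case False
          then show ?thesis using powr_mono[of "1 - \<sigma>" 1 r] \<sigma> by simp
        qed
        then show "norm x powr (1 - \<sigma>) \<le> 1 + norm x" by simp
      qed auto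
      then show "AE x in lborel. norm (norm x powr (1 - \<sigma>) * ?w (norm x) * norm (V x)) \<le> norm (M * (?w (norm x) + norm x * ?w (norm x)))"
        using M0 by (intro AE_I2) (simp add: abs_mult algebra_simps)
    qed simp
    have iFw: "integrable lborel (\<lambda>x. F x * ?w (norm x))"
    proof (rule Bochner_Integration.integrable_bound[OF integrable_mult_right[OF iw(1), of B]])
      show "AE x in lborel. norm (F x * ?w (norm x)) \<le> norm (B * ?w (norm x))"
        using B B0 by (intro AE_I2) (simp add: abs_mult mult_right_mono)
    qed simp
    have iQ: "integrable lborel (\<lambda>x. indicator ?Q x * F x)"
      using borel_integrable_compact[of ?Q F] continuous_on_subset[OF contF] by auto
    note rad = radial_divergence_integral[OF dim F continuous_on_subset[OF V] DERIV_th contth' i1 i2 i3 i4]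
    have iVx: "integrable lborel (\<lambda>x. th (norm x) * (x \<bullet> V x))" by (rule rad(1)) auto
    have 0: "(\<integral>x. F x * (?n * th (norm x) + norm x * th' (norm x)) + th (norm x) * (x \<bullet> V x) \<partial>lborel) = 0"
      by (rule rad(2)) auto
    have iD: "integrable lborel (\<lambda>x. F x * (?n * th (norm x) + norm x * th' (norm x)))"
    proof -
      have "integrable lborel (\<lambda>x. ?n * (F x * th (norm x)) + F x * (norm x * th' (norm x)))" using i2 i3 by simp
      then show ?thesis by (simp add: algebra_simps)
    qed
    have point: "c * (F x * ?w (norm x)) \<le> C * W * (indicator ?Q x * F x)
      + F x * (?n * th (norm x) + norm x * th' (norm x))" if x: "x \<noteq> 0" for x
    proof -
      define s where "s = norm x powr \<sigma>"
      have s: "0 \<le> s" by (simp add: s_def)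
      have "?w (norm x) * indicator {s1..s2} s \<le> W * indicator ?Q x"
      proof (cases "s \<in> {s1..s2}")
        case True
        have r: "norm x = s powr (1 / \<sigma>)" using \<sigma> x by (simp add: s_def powr_powr)
        have "norm x \<le> R" unfolding r R_def using True \<sigma> c by (intro powr_mono2) auto
        then have "x \<in> ?Q" using Basis_le_norm[of _ x] by (force simp: mem_box inner_simps abs_le_iff)
        moreover have "?w (norm x) \<le> norm x powr - \<alpha> * 1" unfolding wt_def using \<kappa> by (intro mult_left_mono) auto
        moreover have "norm x powr - \<alpha> \<le> W" unfolding r W_def using True c \<sigma> \<alpha>
          by (intro powr_mono2' powr_mono2) auto
        ultimately show ?thesis using True by simp
      qed (simp add: W_def)
      from mult_left_mono[OF this, of "C * F x"]
      have 1: "C * (F x * ?w (norm x)) * indicator {s1..s2} s \<le> C * W * (indicator ?Q x * F x)"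
        using c B[of x] by (simp add: mult_ac)
      have "F x * ?w (norm x) * (c - C * indicator {s1..s2} s) \<le> F x * ?w (norm x) * ((?n - \<alpha> - \<kappa> * \<sigma> * s) * field_profile s
        + \<sigma> * (s * field_profile' s))"
        using B[of x] by (intro mult_left_mono P s) auto
      also have "\<dots> = F x * (?n * th (norm x) + norm x * th' (norm x))"
        using div[of "norm x"] x by (simp add: s_def)
      finally show ?thesis using 1 by (simp add: algebra_simps)
    qed
    have "c * (\<integral>x. F x * ?w (norm x) \<partial>lborel) = (\<integral>x. c * (F x * ?w (norm x)) \<partial>lborel)" by simp
    also have "\<dots> \<le> (\<integral>x. C * W * (indicator ?Q x * F x) + F x * (?n * th (norm x) + norm x * th' (norm x)) \<partial>lborel)"
    proof (rule integral_mono_AE)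
      show "AE x in lborel. c * (F x * ?w (norm x)) \<le> C * W * (indicator ?Q x * F x) + F x * (?n * th (norm x) + norm x * th' (norm x))"
        using AE_lborel_singleton[of "0::'a"] by eventually_elim (rule point)
    qed (use iFw iQ iD in auto)
    also have "\<dots> = C * W * (\<integral>x. indicator ?Q x * F x \<partial>lborel) + (\<integral>x. F x * (?n * th (norm x) + norm x * th' (norm x)) \<partial>lborel)"
      using iQ iD by simp
    also have "(\<integral>x. F x * (?n * th (norm x) + norm x * th' (norm x)) \<partial>lborel) = - (\<integral>x. th (norm x) * (x \<bullet> V x) \<partial>lborel)"
      using 0 iD iVx by simp
    also have "\<dots> \<le> (\<integral>x. norm x powr (1 - \<sigma>) * ?w (norm x) * norm (V x) \<partial>lborel)"
    proof -
      have "- (\<integral>x. th (norm x) * (x \<bullet> V x) \<partial>lborel) = (\<integral>x. - (th (norm x) * (x \<bullet> V x)) \<partial>lborel)" by simp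
      also have "\<dots> \<le> (\<integral>x. norm x powr (1 - \<sigma>) * ?w (norm x) * norm (V x) \<partial>lborel)"
      proof (rule integral_mono)
        fix x :: 'a
        have "- (th (norm x) * (x \<bullet> V x)) \<le> \<bar>th (norm x)\<bar> * \<bar>x \<bullet> V x\<bar>" by (metis abs_ge_minus_self abs_mult)
        also have "\<dots> \<le> \<bar>th (norm x)\<bar> * (norm x * norm (V x))"
          by (intro mult_left_mono Cauchy_Schwarz_ineq2) auto
        also have "\<dots> = (norm x * \<bar>th (norm x)\<bar>) * norm (V x)" by simp
        also have "\<dots> \<le> norm x powr (1 - \<sigma>) * ?w (norm x) * norm (V x)"
          by (intro mult_right_mono th_le') auto
        finally show "- (th (norm x) * (x \<bullet> V x)) \<le> norm x powr (1 - \<sigma>) * ?w (norm x) * norm (V x)" .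
      qed (use iVx iV in auto)
      finally show ?thesis .
    qed
    finally have main: "c * (\<integral>x. F x * ?w (norm x) \<partial>lborel) \<le> C * W * (\<integral>x. indicator ?Q x * F x \<partial>lborel)
      + (\<integral>x. norm x powr (1 - \<sigma>) * ?w (norm x) * norm (V x) \<partial>lborel)" by simp
    let ?X = "\<integral>x. indicator ?Q x * F x \<partial>lborel"
    let ?Y = "\<integral>x. norm x powr (1 - \<sigma>) * ?w (norm x) * norm (V x) \<partial>lborel"
    have "0 \<le> ?X" "0 \<le> ?Y" using B by (auto intro!: integral_nonneg)
    then have "C * W * ?X + ?Y \<le> max 1 (C * W) * ?X + max 1 (C * W) * ?Y"
      using mult_right_mono[of 1 "max 1 (C * W)" ?Y] by (intro add_mono mult_right_mono) auto
    with main have "c * (\<integral>x. F x * ?w (norm x) \<partial>lborel) \<le> max 1 (C * W) * (?X + ?Y)" by (simp add: distrib_left)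
    then have "(\<integral>x. F x * ?w (norm x) \<partial>lborel) \<le> K * (?X + ?Y)"
      using c by (simp add: K_def pos_le_divide_eq mult.commute)
    with iV show "integrable lborel (\<lambda>x. norm x powr (1 - \<sigma>) * ?w (norm x) * norm (V x)) \<and>
      (\<integral>x. F x * ?w (norm x) \<partial>lborel) \<le> K * (?X + ?Y)" by blast
  qed
qed

subsection \<open>Unweighted Poincare inequality\<close>

lemma nn_integral_lborel_affine_le:
  fixes h :: "'a::euclidean_space \<Rightarrow> ennreal"
  assumes [measurable]: "h \<in> borel_measurable borel" and c: "1 / 2 \<le> c" "c \<le> 1"
  shows "(\<integral>\<^sup>+x. h (d + c *\<^sub>R x) \<partial>lborel) \<le> 2 ^ DIM('a) * (\<integral>\<^sup>+x. h x \<partial>lborel)"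
proof -
  let ?I = "\<integral>\<^sup>+x. h (d + c *\<^sub>R x) \<partial>lborel"
  have c0: "c \<noteq> 0" using c by auto
  have "(\<integral>\<^sup>+x. h x \<partial>lborel) = ennreal (c ^ DIM('a)) * ?I"
    using c by (subst lborel_affine[OF c0, of d])
      (simp add: nn_integral_density nn_integral_distr nn_integral_cmult ennreal_power)
  then have "2 ^ DIM('a) * (\<integral>\<^sup>+x. h x \<partial>lborel) = ennreal ((2 * c) ^ DIM('a)) * ?I"
    using c by (simp add: power_mult_distrib ennreal_mult mult.assoc flip: ennreal_power)
  moreover have "1 * ?I \<le> ennreal ((2 * c) ^ DIM('a)) * ?I"
    using c one_le_power[of "2 * c" "DIM('a)"] by (intro mult_right_mono) (simp_all add: ennreal_1[symmetric] del: ennreal_1)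
  ultimately show ?thesis by simp
qed

text \<open>Each of the two halves of the segment from \<open>x\<close> to \<open>y\<close> is handled by contracting towards
  its far end point by a factor of at least \<open>1/2\<close>, so that the change of variables
  costs at most \<open>2 ^ n\<close>.\<close>

lemma L1_poincare_cbox:
  fixes a b :: "'a::euclidean_space"
  assumes Q: "Q = cbox a b" and pos: "0 < measure lborel Q"
  obtains C where "0 < C" and
    "\<And>f V. (\<And>x. GDERIV f x :> V x) \<Longrightarrow> continuous_on UNIV V \<Longrightarrow>
      (\<integral>x. indicator Q x * f x \<partial>lborel) = 0 \<Longrightarrow>
      (\<integral>x. indicator Q x * \<bar>f x\<bar> \<partial>lborel) \<le> C * (\<integral>x. indicator Q x * norm (V x) \<partial>lborel)"
proof -
  have bQ: "bounded Q" "convex Q" "compact Q" and [measurable]: "Q \<in> sets borel" by (auto simp: Q)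
  obtain D where D: "0 < D" "\<And>x. x \<in> Q \<Longrightarrow> norm x \<le> D" using bQ(1) by (auto simp: bounded_pos)
  have eQ: "emeasure lborel Q = ennreal (measure lborel Q)"
    using emeasure_bounded_finite[OF bQ(1)] by (intro emeasure_eq_ennreal_measure) auto
  \<comment> \<open>Two half segments, the bound 2 D for the distance of two points of Q, and the
    cost 2 ^ n of the change of variables.\<close>
  define C where "C = 2 * (2 * D) * 2 ^ DIM('a)"
  show ?thesis
  proof (rule that[of C])
    show "0 < C" using D by (simp add: C_def)
    fix f :: "'a \<Rightarrow> real" and V :: "'a \<Rightarrow> 'a"
    assume f: "\<And>x. GDERIV f x :> V x" and V: "continuous_on UNIV V"
      and mean: "(\<integral>x. indicator Q x * f x \<partial>lborel) = 0"
    have contf: "continuous_on UNIV f"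
      using f by (intro continuous_at_imp_continuous_on ballI has_derivative_continuous) (auto simp: gderiv_def)
    have [measurable]: "f \<in> borel_measurable borel" "V \<in> borel_measurable borel"
      using contf V by (auto intro: borel_measurable_continuous_onI)
    have intf: "integrable lborel (\<lambda>x. indicator Q x * f x)"
      using borel_integrable_compact[OF bQ(3), of f] continuous_on_subset[OF contf] by auto
    have intV: "integrable lborel (\<lambda>x. indicator Q x * norm (V x))"
      using borel_integrable_compact[OF bQ(3), of "\<lambda>x. norm (V x)"] continuous_on_subset[OF V]
      by (auto intro!: continuous_intros)
    define h where "h x = ennreal (indicator Q x * norm (V x))" for x
    have [measurable]: "h \<in> borel_measurable borel" unfolding h_def by measurable
    define I where "I = (\<integral>x. indicator Q x * norm (V x) \<partial>lborel)"
    have I: "(\<integral>\<^sup>+x. h x \<partial>lborel) = ennreal I" "0 \<le> I"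
      unfolding h_def I_def by (rule nn_integral_eq_integral[OF intV]) (auto intro!: integral_nonneg)
    define mid where "mid x y = (1/2::real) *\<^sub>R (x + y)" for x y :: 'a
    have seg: "ennreal \<bar>f (mid x y) - f x\<bar> \<le> (\<integral>\<^sup>+t. indicator {0..1/2::real} t * (ennreal (2 * D) * h (t *\<^sub>R y + (1 - t) *\<^sub>R x)) \<partial>lborel)"
      if xy: "x \<in> Q" "y \<in> Q" for x y
    proof -
      define z where "z t = t *\<^sub>R y + (1 - t) *\<^sub>R x" for t
      have zQ: "z t \<in> Q" if "t \<in> {0..1/2}" for t
        using that convexD[OF bQ(2) xy(2,1), of t "1 - t"] by (auto simp: z_def)
      have contz: "continuous_on A z" for A unfolding z_def by (intro continuous_intros)
      have "((\<lambda>t. f (z t)) has_vector_derivative ((y - x) \<bullet> V (z t))) (at t within A)" for t A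
      proof -
        have "(z has_derivative (\<lambda>s. s *\<^sub>R (y - x))) (at t within A)"
          unfolding z_def by (auto intro!: derivative_eq_intros simp: algebra_simps)
        moreover have "(f has_derivative (\<lambda>h. h \<bullet> V (z t))) (at (z t))" using f[of "z t"] by (simp add: gderiv_def)
        ultimately have "((\<lambda>t. f (z t)) has_derivative (\<lambda>s. (s *\<^sub>R (y - x)) \<bullet> V (z t))) (at t within A)"
          using has_derivative_compose by blast
        then show ?thesis by (simp add: has_vector_derivative_def)
      qed
      then have "has_bochner_integral lborel (\<lambda>t. indicator {0..1/2} t *\<^sub>R ((y - x) \<bullet> V (z t))) (f (z (1/2)) - f (z 0))"
        by (intro has_bochner_integral_FTC_Icc continuous_intros continuous_on_compose2[OF V] contz) auto
      then have "f (z (1/2)) - f (z 0) = (\<integral>t. indicator {0..1/2} t *\<^sub>R ((y - x) \<bullet> V (z t)) \<partial>lborel)"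
        and int: "integrable lborel (\<lambda>t. indicator {0..1/2} t *\<^sub>R ((y - x) \<bullet> V (z t)))"
        by (simp_all add: has_bochner_integral_iff)
      moreover have "z (1/2) = mid x y" "z 0 = x" by (simp_all add: z_def mid_def scaleR_add_right)
      ultimately have "ennreal \<bar>f (mid x y) - f x\<bar> \<le> (\<integral>\<^sup>+t. ennreal (norm (indicator {0..1/2} t *\<^sub>R ((y - x) \<bullet> V (z t)))) \<partial>lborel)"
        using integral_norm_bound_ennreal[OF int] by simp
      also have "\<dots> \<le> (\<integral>\<^sup>+t. indicator {0..1/2} t * (ennreal (2 * D) * h (z t)) \<partial>lborel)"
      proof (intro nn_integral_mono)
        fix t :: real
        show "ennreal (norm (indicator {0..1/2} t *\<^sub>R ((y - x) \<bullet> V (z t)))) \<le> indicator {0..1/2} t * (ennreal (2 * D) * h (z t))"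
        proof (cases "t \<in> {0..1/2}")
          case True
          have "\<bar>(y - x) \<bullet> V (z t)\<bar> \<le> norm (y - x) * norm (V (z t))" by (rule Cauchy_Schwarz_ineq2)
          also have "\<dots> \<le> 2 * D * norm (V (z t))"
            using norm_triangle_ineq4[of y x] D(2)[OF xy(1)] D(2)[OF xy(2)] by (intro mult_right_mono) auto
          finally show ?thesis using True zQ[OF True] D by (simp add: h_def ennreal_mult'[symmetric] ennreal_leI)
        qed simp
      qed
      finally show ?thesis by (simp add: z_def)
    qed
    define B where "B = ennreal (2 * D) * 2 ^ DIM('a) * ennreal I * ennreal (measure lborel Q)"
    have half: "(\<integral>\<^sup>+y. \<integral>\<^sup>+x. indicator Q y * (indicator Q x * ennreal \<bar>f (mid x y) - f x\<bar>) \<partial>lborel \<partial>lborel) \<le> B"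
    proof -
      have "(\<integral>\<^sup>+x. indicator Q y * (indicator Q x * ennreal \<bar>f (mid x y) - f x\<bar>) \<partial>lborel)
        \<le> indicator Q y * (ennreal (2 * D) * 2 ^ DIM('a) * ennreal I)" for y
      proof (cases "y \<in> Q")
        case True
        have "(\<integral>\<^sup>+x. indicator Q y * (indicator Q x * ennreal \<bar>f (mid x y) - f x\<bar>) \<partial>lborel)
          \<le> (\<integral>\<^sup>+x. \<integral>\<^sup>+t. indicator {0..1/2::real} t * (ennreal (2 * D) * h (t *\<^sub>R y + (1 - t) *\<^sub>R x)) \<partial>lborel \<partial>lborel)"
          using True seg[OF _ True] by (intro nn_integral_mono) (auto split: split_indicator)
        also have "\<dots> = (\<integral>\<^sup>+t. \<integral>\<^sup>+x. indicator {0..1/2::real} t * (ennreal (2 * D) * h (t *\<^sub>R y + (1 - t) *\<^sub>R x)) \<partial>lborel \<partial>lborel)"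
          by (rule lborel_pair.Fubini'[symmetric]) measurable
        \<comment> \<open>For t in [0, 1/2] the contraction factor 1 - t is at least 1/2. Widening
          the interval to [0, 1] makes the remaining t-integral equal to 1.\<close>
        also have "\<dots> \<le> (\<integral>\<^sup>+t. indicator {0..1::real} t * (ennreal (2 * D) * (2 ^ DIM('a) * (\<integral>\<^sup>+x. h x \<partial>lborel))) \<partial>lborel)"
        proof (intro nn_integral_mono)
          fix t :: real
          show "(\<integral>\<^sup>+x. indicator {0..1/2::real} t * (ennreal (2 * D) * h (t *\<^sub>R y + (1 - t) *\<^sub>R x)) \<partial>lborel)
            \<le> indicator {0..1::real} t * (ennreal (2 * D) * (2 ^ DIM('a) * (\<integral>\<^sup>+x. h x \<partial>lborel)))"
            using nn_integral_lborel_affine_le[of h "1 - t" "t *\<^sub>R y"]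
            by (auto simp: nn_integral_cmult split: split_indicator intro!: mult_left_mono)
        qed
        also have "\<dots> = ennreal (2 * D) * (2 ^ DIM('a) * ennreal I)"
          by (simp add: nn_integral_multc I)
        finally show ?thesis using True by (simp add: mult.assoc)
      qed simp
      then have "(\<integral>\<^sup>+y. \<integral>\<^sup>+x. indicator Q y * (indicator Q x * ennreal \<bar>f (mid x y) - f x\<bar>) \<partial>lborel \<partial>lborel)
        \<le> (\<integral>\<^sup>+y. indicator Q y * (ennreal (2 * D) * 2 ^ DIM('a) * ennreal I) \<partial>lborel)"
        by (rule nn_integral_mono)
      also have "\<dots> = B" by (simp add: nn_integral_multc eQ B_def mult.commute)
      finally show ?thesis .
    qed
    have mid_commute: "mid x y = mid y x" for x y by (simp add: mid_def add.commute)
    have [measurable]: "(\<lambda>(x, y). mid x y) \<in> borel_measurable (borel \<Otimes>\<^sub>M borel)" unfolding mid_def by measurable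
    \<comment> \<open>The midpoint is symmetric in x and y, so exchanging the integrals reduces the
      second half segment to the first.\<close>
    have half': "(\<integral>\<^sup>+y. \<integral>\<^sup>+x. indicator Q y * (indicator Q x * ennreal \<bar>f (mid x y) - f y\<bar>) \<partial>lborel \<partial>lborel) \<le> B"
    proof -
      have "(\<integral>\<^sup>+y. \<integral>\<^sup>+x. indicator Q y * (indicator Q x * ennreal \<bar>f (mid x y) - f y\<bar>) \<partial>lborel \<partial>lborel)
        = (\<integral>\<^sup>+x. \<integral>\<^sup>+y. indicator Q y * (indicator Q x * ennreal \<bar>f (mid x y) - f y\<bar>) \<partial>lborel \<partial>lborel)"
        by (rule lborel_pair.Fubini') (simp add: mid_def)
      also have "\<dots> \<le> B" using half by (simp add: mid_commute mult.left_commute)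
      finally show ?thesis .
    qed
    \<comment> \<open>Mean zero turns |Q| f(x) into the integral of f(x) - f(y) over y in Q, which
      is split at the midpoint.\<close>
    have *: "ennreal (measure lborel Q * (indicator Q x * \<bar>f x\<bar>))
      \<le> (\<integral>\<^sup>+y. indicator Q y * (indicator Q x * ennreal \<bar>f (mid x y) - f x\<bar>) + indicator Q y * (indicator Q x * ennreal \<bar>f (mid x y) - f y\<bar>) \<partial>lborel)" for x
    proof (cases "x \<in> Q")
      case True
      have intQ: "integrable lborel (indicator Q :: 'a \<Rightarrow> real)" using emeasure_bounded_finite[OF bQ(1)] by simp
      have "(\<integral>y. indicator Q y * f x - indicator Q y * f y \<partial>lborel) = measure lborel Q * f x"
        using intf intQ mean by simp
      moreover have "integrable lborel (\<lambda>y. indicator Q y * f x - indicator Q y * f y)" using intf intQ by simp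
      ultimately have "ennreal (norm (measure lborel Q * f x)) \<le> (\<integral>\<^sup>+y. norm (indicator Q y * f x - indicator Q y * f y) \<partial>lborel)"
        using integral_norm_bound_ennreal by metis
      also have "\<dots> \<le> (\<integral>\<^sup>+y. indicator Q y * (indicator Q x * ennreal \<bar>f (mid x y) - f x\<bar>) + indicator Q y * (indicator Q x * ennreal \<bar>f (mid x y) - f y\<bar>) \<partial>lborel)"
        using True by (intro nn_integral_mono) (auto split: split_indicator simp flip: ennreal_plus intro!: ennreal_leI)
      finally show ?thesis using True by (simp add: abs_mult)
    qed simp
    have "ennreal (measure lborel Q * (\<integral>x. indicator Q x * \<bar>f x\<bar> \<partial>lborel))
      = (\<integral>\<^sup>+x. ennreal (measure lborel Q * (indicator Q x * \<bar>f x\<bar>)) \<partial>lborel)"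
      using integrable_abs[OF intf] by (subst nn_integral_eq_integral) (auto simp: abs_mult)
    also have "\<dots> \<le> (\<integral>\<^sup>+x. \<integral>\<^sup>+y. indicator Q y * (indicator Q x * ennreal \<bar>f (mid x y) - f x\<bar>) + indicator Q y * (indicator Q x * ennreal \<bar>f (mid x y) - f y\<bar>) \<partial>lborel \<partial>lborel)"
      by (rule nn_integral_mono[OF *])
    also have "\<dots> = (\<integral>\<^sup>+y. \<integral>\<^sup>+x. indicator Q y * (indicator Q x * ennreal \<bar>f (mid x y) - f x\<bar>) + indicator Q y * (indicator Q x * ennreal \<bar>f (mid x y) - f y\<bar>) \<partial>lborel \<partial>lborel)"
      by (rule lborel_pair.Fubini'[symmetric]) (simp add: mid_def)
    also have "\<dots> = (\<integral>\<^sup>+y. \<integral>\<^sup>+x. indicator Q y * (indicator Q x * ennreal \<bar>f (mid x y) - f x\<bar>) \<partial>lborel \<partial>lborel)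
       + (\<integral>\<^sup>+y. \<integral>\<^sup>+x. indicator Q y * (indicator Q x * ennreal \<bar>f (mid x y) - f y\<bar>) \<partial>lborel \<partial>lborel)"
      unfolding mid_def by (simp add: nn_integral_add)
    also have "\<dots> \<le> B + B" by (intro add_mono half half')
    also have "\<dots> = ennreal (measure lborel Q * (C * I))"
      using D I pos by (simp add: B_def C_def ennreal_mult mult_ac flip: ennreal_power ennreal_plus mult_2)
    finally have "measure lborel Q * (\<integral>x. indicator Q x * \<bar>f x\<bar> \<partial>lborel) \<le> measure lborel Q * (C * I)"
      using pos D I by (subst (asm) ennreal_le_iff) (auto simp: C_def)
    then show "(\<integral>x. indicator Q x * \<bar>f x\<bar> \<partial>lborel) \<le> C * (\<integral>x. indicator Q x * norm (V x) \<partial>lborel)"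
      using pos by (simp add: I_def)
  qed
qed

subsection \<open>Weighted Poincare inequality for the Bregman remainder\<close>

text \<open>The sign makes a vanishing mean possible while keeping the modulus of the function and
  of its derivative, so the cube inequality for this function bounds the integral of
  \<open>orlicz\<close> itself.\<close>

definition signed_orlicz :: "real \<Rightarrow> real \<Rightarrow> real \<Rightarrow> real" where
  "signed_orlicz p m t = sgn t * orlicz p m t"

lemma abs_signed_orlicz: "0 < p \<Longrightarrow> \<bar>signed_orlicz p m t\<bar> = orlicz p m t"
  by (cases "t = 0") (simp_all add: signed_orlicz_def abs_mult orlicz_nonneg)

lemma DERIV_signed_orlicz:
  assumes p: "1 < p"
  shows "(signed_orlicz p m has_real_derivative p * \<bar>t\<bar> * (m\<^sup>2 + t\<^sup>2) powr (p / 2 - 1)) (at t)"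
proof -
  consider "t = 0" | "0 < t" | "t < 0" by linarith
  then show ?thesis
  proof cases
    case 1
    have d: "((\<lambda>h. orlicz p m h / h) \<longlongrightarrow> 0) (at 0)"
      using DERIV_orlicz[OF p, of m 0] by (simp add: DERIV_def)
    have "\<forall>\<^sub>F h in at 0. norm (signed_orlicz p m h / h) \<le> norm (orlicz p m h / h)"
      using p by (simp add: abs_divide abs_signed_orlicz orlicz_nonneg)
    then have "((\<lambda>h. signed_orlicz p m h / h) \<longlongrightarrow> 0) (at 0)"
      by (rule Lim_null_comparison[OF _ tendsto_norm_zero[OF d]])
    then show ?thesis using 1 by (simp add: DERIV_def signed_orlicz_def)
  next
    case 2
    have "(orlicz p m has_real_derivative p * \<bar>t\<bar> * (m\<^sup>2 + t\<^sup>2) powr (p / 2 - 1)) (at t)"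
      using DERIV_orlicz[OF p, of m t] 2 by simp
    then show ?thesis
      by (rule has_field_derivative_transform_within_open[of _ _ _ "{0<..}"]) (use 2 in \<open>auto simp: signed_orlicz_def\<close>)
  next
    case 3
    have "((\<lambda>t. - orlicz p m t) has_real_derivative p * \<bar>t\<bar> * (m\<^sup>2 + t\<^sup>2) powr (p / 2 - 1)) (at t)"
      using DERIV_minus[OF DERIV_orlicz[OF p, of m t]] 3 by simp
    then show ?thesis
      by (rule has_field_derivative_transform_within_open[of _ _ _ "{..<0}"]) (use 3 in \<open>auto simp: signed_orlicz_def\<close>)
  qed
qed

lemma continuous_on_orlicz [continuous_intros]:
  assumes "0 < p" "continuous_on S m" "continuous_on S t"
  shows "continuous_on S (\<lambda>x. orlicz p (m x) (t x))"
  unfolding orlicz_def using assms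
  by (intro continuous_on_diff continuous_on_powr' continuous_on_add continuous_on_power continuous_on_rabs continuous_on_const) auto

lemma continuous_on_signed_orlicz:
  assumes "0 < p" "continuous_on S m" "continuous_on S t"
  shows "continuous_on S (\<lambda>x. signed_orlicz p (m x) (t x))"
proof -
  \<comment> \<open>This form avoids the jump of \<open>sgn\<close>: the two pieces agree at t = 0
    because \<open>orlicz\<close> vanishes there.\<close>
  have eq: "signed_orlicz p m t = orlicz p m (max t 0) - orlicz p m (min t 0)" for m t
    by (cases "t = 0"; cases "0 < t") (simp_all add: signed_orlicz_def)
  show ?thesis unfolding eq using assms by (intro continuous_intros) auto
qed

text \<open>Intermediate value theorem in m: the integrand is nonpositive for m = G and nonnegative
  for m = - G. No explicit mean is used, since m enters both arguments of
  \<open>signed_orlicz\<close>.\<close>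

lemma exists_signed_orlicz_mean_zero:
  fixes g :: "'a::euclidean_space \<Rightarrow> real"
  assumes p: "0 < p" and g: "continuous_on UNIV g" and G: "\<And>x. \<bar>g x\<bar> \<le> G"
  obtains m where "(\<integral>x. indicator (cbox l r) x * signed_orlicz p m (g x - m) \<partial>lborel) = 0"
proof -
  define h where "h m = (\<integral>x. indicator (cbox l r) x * signed_orlicz p m (g x - m) \<partial>lborel)" for m
  have cont: "continuous_on S (\<lambda>x. signed_orlicz p m (g x - m))" for S m
    using p continuous_on_subset[OF g] by (intro continuous_on_signed_orlicz continuous_intros) auto
  have h: "h m = integral (cbox l r) (\<lambda>x. signed_orlicz p m (g x - m))" for m
  proof -
    have "set_integrable lborel (cbox l r) (\<lambda>x. signed_orlicz p m (g x - m))"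
      unfolding set_integrable_def by (intro borel_integrable_compact cont) simp
    from set_borel_integral_eq_integral(2)[OF this] show ?thesis
      by (simp add: h_def set_lebesgue_integral_def)
  qed
  have "continuous_on {-G..G} h"
    unfolding h[abs_def]
  proof (rule integral_continuous_on_param)
    show "continuous_on ({-G..G} \<times> cbox l r) (\<lambda>(m, x). signed_orlicz p m (g x - m))"
      unfolding case_prod_beta
      by (intro continuous_on_signed_orlicz p continuous_intros continuous_on_compose2[OF g]) auto
  qed
  moreover have "h G \<le> 0"
  proof -
    have "0 \<le> (\<integral>x. - (indicator (cbox l r) x * signed_orlicz p G (g x - G)) \<partial>lborel)"
    proof (rule Bochner_Integration.integral_nonneg)
      fix x
      have "g x - G \<le> 0" using G[of x] by linarith
      then show "0 \<le> - (indicator (cbox l r) x * signed_orlicz p G (g x - G))"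
        using p orlicz_nonneg[of p G "g x - G"] by (simp add: signed_orlicz_def sgn_if indicator_def)
    qed
    then show ?thesis by (simp add: h_def)
  qed
  moreover have "0 \<le> h (- G)"
    unfolding h_def
  proof (rule Bochner_Integration.integral_nonneg)
    fix x
    have "0 \<le> g x - - G" using G[of x] by linarith
    then show "0 \<le> indicator (cbox l r) x * signed_orlicz p (- G) (g x - - G)"
      using p orlicz_nonneg[of p "- G" "g x - - G"] by (simp add: signed_orlicz_def sgn_if indicator_def)
  qed
  moreover have "- G \<le> G" using G[of undefined] by linarith
  ultimately obtain m where "h m = 0" using IVT2'[of h G 0 "- G"] by auto
  then show ?thesis using that by (simp add: h_def)
qed

text \<open>The gradient is an explicit datum, so one predicate covers both u and its quotient by
  the extremal function. Vanishing near the origin and near infinity makes power weights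
  harmless.\<close>

definition punctured_test :: "('a::euclidean_space \<Rightarrow> real) \<Rightarrow> ('a \<Rightarrow> 'a) \<Rightarrow> bool" where
  "punctured_test u du \<longleftrightarrow> (\<forall>x. GDERIV u x :> du x) \<and> continuous_on UNIV du
    \<and> (\<exists>\<epsilon>>0. \<forall>x. norm x < \<epsilon> \<longrightarrow> u x = 0 \<and> du x = 0) \<and> (\<exists>L. \<forall>x. L < norm x \<longrightarrow> u x = 0 \<and> du x = 0)"

lemma punctured_testD:
  assumes "punctured_test u du"
  shows "GDERIV u x :> du x" "continuous_on S du" "continuous_on S u" "u 0 = 0" "du 0 = 0"
proof -
  show "GDERIV u x :> du x" "continuous_on S du" "u 0 = 0" "du 0 = 0"
    using assms by (auto simp: punctured_test_def intro: continuous_on_subset)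
  show "continuous_on S u"
    using assms unfolding punctured_test_def gderiv_def
    by (intro continuous_at_imp_continuous_on ballI has_derivative_continuous) blast
qed

lemma integrable_annulus:
  fixes f :: "'a::euclidean_space \<Rightarrow> real"
  assumes "continuous_on (- {0}) f" "0 < \<epsilon>" "\<And>x. norm x < \<epsilon> \<Longrightarrow> f x = 0" "\<And>x. L < norm x \<Longrightarrow> f x = 0"
  shows "integrable lborel f"
proof -
  have "compact (cball 0 L - ball 0 \<epsilon> :: 'a set)" by (intro compact_diff) auto
  moreover have "continuous_on (cball 0 L - ball 0 \<epsilon>) f"
    using assms(2) by (intro continuous_on_subset[OF assms(1)]) auto
  ultimately have "integrable lborel (\<lambda>x. indicator (cball 0 L - ball 0 \<epsilon>) x *\<^sub>R f x)"
    by (rule borel_integrable_compact)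
  moreover have "(\<lambda>x. indicator (cball 0 L - ball 0 \<epsilon>) x *\<^sub>R f x) = f"
  proof
    fix x
    show "indicator (cball 0 L - ball 0 \<epsilon>) x *\<^sub>R f x = f x"
      using assms(3,4)[of x] by (cases "norm x < \<epsilon>"; cases "L < norm x") (auto simp: indicator_def)
  qed
  ultimately show ?thesis by simp
qed

lemma integrable_punctured_test:
  fixes f :: "'a::euclidean_space \<Rightarrow> real"
  assumes "punctured_test u du" "continuous_on (- {0}) f" "\<And>x. u x = 0 \<Longrightarrow> du x = 0 \<Longrightarrow> f x = 0"
  shows "integrable lborel f"
proof -
  obtain \<epsilon> L where "0 < \<epsilon>" "\<And>x. norm x < \<epsilon> \<Longrightarrow> u x = 0 \<and> du x = 0" "\<And>x. L < norm x \<Longrightarrow> u x = 0 \<and> du x = 0"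
    using assms(1) unfolding punctured_test_def by metis
  then show ?thesis using assms(3) by (intro integrable_annulus[OF assms(2), of \<epsilon> L]) simp_all
qed

text \<open>Multiplication by \<open>exp (|x|\<^sup>\<sigma> / \<sigma>)\<close> divides by the extremal function \<open>exp (- |x|\<^sup>\<sigma> / \<sigma>)\<close>.\<close>

lemma punctured_test_div_extremal:
  fixes u :: "'a::euclidean_space \<Rightarrow> real"
  assumes u: "punctured_test u du" and \<sigma>: "0 < \<sigma>"
  shows "punctured_test (\<lambda>x. u x * exp (norm x powr \<sigma> / \<sigma>))
    (\<lambda>x. exp (norm x powr \<sigma> / \<sigma>) *\<^sub>R (du x + (u x * norm x powr (\<sigma> - 1)) *\<^sub>R sgn x))"
    (is "punctured_test ?g ?dg")
proof -
  obtain \<epsilon> where \<epsilon>: "0 < \<epsilon>" "\<And>x. norm x < \<epsilon> \<Longrightarrow> u x = 0 \<and> du x = 0" using u unfolding punctured_test_def by blast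
  have "GDERIV ?g x :> ?dg x" for x
  proof (cases "x = 0")
    case True
    \<comment> \<open>The exponential factor need not be differentiable at the origin, but u
      vanishes on a ball around it.\<close>
    have "(?g has_derivative (\<lambda>h. 0)) (at x)"
      by (rule has_derivative_transform_within_open[of "\<lambda>_. 0" _ _ _ "ball 0 \<epsilon>"]) (use True \<epsilon> in auto)
    then show ?thesis using True punctured_testD(4,5)[OF u] by (simp add: gderiv_def)
  next
    case False
    have "((\<lambda>r. exp (r powr \<sigma> / \<sigma>)) has_real_derivative exp (norm x powr \<sigma> / \<sigma>) * norm x powr (\<sigma> - 1)) (at (norm x))"
      using False \<sigma> by (auto intro!: derivative_eq_intros)
    from GDERIV_DERIV_compose[OF GDERIV_norm[OF False] this]
    have "GDERIV ?g x :> u x *\<^sub>R ((exp (norm x powr \<sigma> / \<sigma>) * norm x powr (\<sigma> - 1)) *\<^sub>R sgn x)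
        + exp (norm x powr \<sigma> / \<sigma>) *\<^sub>R du x"
      by (intro GDERIV_mult punctured_testD(1)[OF u])
    then show ?thesis by (rule GDERIV_subst) (simp add: algebra_simps)
  qed
  moreover have "continuous_on UNIV ?dg"
  proof -
    have "continuous_on (- {0}) ?dg"
      using \<sigma> by (intro continuous_intros punctured_testD[OF u]) auto
    moreover have "continuous_on (ball 0 \<epsilon>) ?dg"
      using \<epsilon> by (subst continuous_on_cong[where g = "\<lambda>_. 0", OF refl]) auto
    ultimately have "continuous_on (- {0} \<union> ball 0 \<epsilon>) ?dg" by (intro continuous_on_open_Un) auto
    moreover have "- {0} \<union> ball 0 \<epsilon> = (UNIV :: 'a set)" using \<epsilon> by auto
    ultimately show ?thesis by simp
  qed
  moreover have "\<exists>\<epsilon>>0. \<forall>x. norm x < \<epsilon> \<longrightarrow> ?g x = 0 \<and> ?dg x = 0" using \<epsilon> by (intro exI[of _ \<epsilon>]) simp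
  moreover have "\<exists>L. \<forall>x. L < norm x \<longrightarrow> ?g x = 0 \<and> ?dg x = 0"
  proof -
    obtain L where "\<And>x. L < norm x \<Longrightarrow> u x = 0 \<and> du x = 0" using u unfolding punctured_test_def by metis
    then show ?thesis by (intro exI[of _ L]) simp
  qed
  ultimately show ?thesis unfolding punctured_test_def by (intro conjI allI)
qed

lemma punctured_test_bounded:
  assumes u: "punctured_test u du"
  obtains G where "\<And>x. \<bar>u x\<bar> \<le> G"
proof -
  obtain L where L: "\<And>x. L < norm x \<Longrightarrow> u x = 0" using u unfolding punctured_test_def by metis
  have "compact (u ` cball 0 L)" by (intro compact_continuous_image punctured_testD[OF u]) auto
  then obtain M where M: "\<And>x. x \<in> cball 0 L \<Longrightarrow> \<bar>u x\<bar> \<le> M"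
    by (force dest!: compact_imp_bounded simp: bounded_iff)
  then have "\<bar>u x\<bar> \<le> max 0 M" for x
    using L[of x] by (cases "L < norm x") (simp_all add: le_max_iff_disj)
  then show ?thesis by (rule that)
qed

text \<open>For m = 0 the power has a negative exponent and is singular as t tends to 0, yet the
  product is sgn t * |t| powr (p - 1), which is continuous for \<open>1 < p\<close>; it is written
  through positive and negative parts.\<close>

lemma continuous_on_orlicz_deriv:
  fixes p m :: real
  assumes "1 < p" "continuous_on S t"
  shows "continuous_on S (\<lambda>x. t x * (m\<^sup>2 + (t x)\<^sup>2) powr (p / 2 - 1))"
proof (cases "m = 0")
  case True
  have "s * (s\<^sup>2) powr (p / 2 - 1) = max s 0 powr (p - 1) - max (- s) 0 powr (p - 1)" for s :: real
    using square_powr_half[of s "p - 2"] powr_add[of "\<bar>s\<bar>" "p - 2" 1] assms(1)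
    by (cases "s = 0"; cases "0 < s") (auto simp: diff_divide_distrib mult.commute)
  moreover have "continuous_on S (\<lambda>x. max (t x) 0 powr (p - 1) - max (- t x) 0 powr (p - 1))"
    using assms by (intro continuous_on_diff continuous_on_powr' continuous_intros) auto
  ultimately show ?thesis using True by simp
next
  case False
  have "m\<^sup>2 + (t x)\<^sup>2 \<noteq> 0" for x using False by (simp add: sum_power2_eq_zero_iff)
  then show ?thesis using assms by (intro continuous_intros) auto
qed

section \<open>The fields A and B of the overview, and the remainder in terms of g\<close>

definition weighted_grad :: "real \<Rightarrow> ('a::euclidean_space \<Rightarrow> 'a) \<Rightarrow> 'a \<Rightarrow> 'a" where
  "weighted_grad b du x = norm x powr - b *\<^sub>R du x"

definition radial_term :: "real \<Rightarrow> ('a::euclidean_space \<Rightarrow> real) \<Rightarrow> 'a \<Rightarrow> 'a" where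
  "radial_term a u x = (u x * norm x powr - a) *\<^sub>R sgn x"

text \<open>The lower bound in \<open>bregman_powr_vector\<close> without its factor
  \<open>(p - 1) / 4\<close>.\<close>

definition excess :: "real \<Rightarrow> real \<Rightarrow> real \<Rightarrow> ('a::euclidean_space \<Rightarrow> real) \<Rightarrow> ('a \<Rightarrow> 'a) \<Rightarrow> 'a \<Rightarrow> real" where
  "excess p a b u du x = (norm (weighted_grad b du x + radial_term a u x))\<^sup>2
    * (norm (radial_term a u x) + norm (weighted_grad b du x + radial_term a u x)) powr (p - 2)"

lemma excess_nonneg [simp]: "0 \<le> excess p a b u du x"
  by (simp add: excess_def)

text \<open>B and A + B share the factor K = |x| powr (- a) * U, leaving |g| and z; the expression
  is homogeneous of degree p, and K powr p is the weight. At the origin both sides vanish because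
  \<open>0 powr y = 0\<close>.\<close>

lemma excess_eq:
  fixes u :: "'a::euclidean_space \<Rightarrow> real" and du :: "'a \<Rightarrow> 'a" and p a b :: real
  assumes \<sigma>: "\<sigma> = b - a + 1" "0 < \<sigma>"
  defines "g \<equiv> \<lambda>x. u x * exp (norm x powr \<sigma> / \<sigma>)"
  defines "z \<equiv> \<lambda>x. norm x powr (1 - \<sigma>)
    * norm (exp (norm x powr \<sigma> / \<sigma>) *\<^sub>R (du x + (u x * norm x powr (\<sigma> - 1)) *\<^sub>R sgn x))"
  shows "excess p a b u du x = wt (p * a) (p / \<sigma>) \<sigma> (norm x) * ((z x)\<^sup>2 * (\<bar>g x\<bar> + z x) powr (p - 2))"
proof (cases "x = 0")
  case True
  then show ?thesis by (simp add: excess_def weighted_grad_def radial_term_def wt_def)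
next
  case False
  define r where "r = norm x"
  define s where "s = r powr \<sigma> / \<sigma>"
  define K where "K = r powr - a * exp (- s)"
  have r: "0 < r" using False by (simp add: r_def)
  have K: "0 < K" using r by (simp add: K_def)
  have z0: "0 \<le> z x" by (simp add: z_def)
  have nB: "norm (radial_term a u x) = K * \<bar>g x\<bar>"
    using False by (simp add: radial_term_def K_def g_def s_def r_def norm_sgn abs_mult flip: exp_add)
  have "r powr - b * (u x * r powr (\<sigma> - 1)) = u x * r powr - a"
    by (simp add: \<sigma>(1) mult.left_commute flip: powr_add)
  then have "weighted_grad b du x + radial_term a u x
    = r powr - b *\<^sub>R (du x + (u x * r powr (\<sigma> - 1)) *\<^sub>R sgn x)"
    by (auto simp: weighted_grad_def radial_term_def r_def[symmetric] scaleR_add_right)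
  also have "\<dots> = (r powr - b * exp (- s)) *\<^sub>R (exp s *\<^sub>R (du x + (u x * r powr (\<sigma> - 1)) *\<^sub>R sgn x))"
    by (simp add: exp_minus)
  finally have nZ: "norm (weighted_grad b du x + radial_term a u x) = K * z x"
    using r powr_add[of r "- a" "1 - \<sigma>"] by (simp add: K_def z_def \<sigma>(1) s_def r_def[symmetric] mult_ac)
  have "excess p a b u du x = (K * z x)\<^sup>2 * (K * (\<bar>g x\<bar> + z x)) powr (p - 2)"
    by (simp add: excess_def nB nZ distrib_left)
  also have "\<dots> = K\<^sup>2 * K powr (p - 2) * ((z x)\<^sup>2 * (\<bar>g x\<bar> + z x) powr (p - 2))"
    using K z0 by (simp add: powr_mult power_mult_distrib)
  also have "K\<^sup>2 * K powr (p - 2) = K powr p" using K by (simp flip: powr_numeral powr_add)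
  also have "K powr p = wt (p * a) (p / \<sigma>) \<sigma> r"
    using r by (simp add: K_def wt_def powr_mult powr_powr s_def exp_powr_real mult_ac)
  finally show ?thesis by (simp add: r_def)
qed

lemma half_pow_mult_pos: "0 < c \<Longrightarrow> half_pow p (c * s) = c powr (p / 2) * half_pow p s"
  using powr_add[of c "(p - 2) / 2" 1]
  by (simp add: half_pow_def abs_mult powr_mult diff_divide_distrib)

text \<open>The absorption argument, with X, Y and E the weighted integrals of the test function, of
  its gradient and of the remainder. The witness c is the constant m of the mean-zero
  condition.\<close>

lemma weighted_bregman_poincare:
  fixes p a b :: real
  assumes dim: "2 \<le> DIM('a::euclidean_space)" and p: "1 < p" "p < 2"
    and ab: "0 \<le> b" "b \<le> a" "a < b + 1" and pa: "p * a < DIM('a)"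
  obtains C where "0 < C"
    "\<And>(u :: 'a \<Rightarrow> real) du. punctured_test u du \<Longrightarrow> integrable lborel (excess p a b u du) \<Longrightarrow>
      \<exists>c. (\<integral>x. \<bar>half_pow p (u x) - half_pow p c * exp (- (p / 2 * norm x powr (b - a + 1) / (b - a + 1)))\<bar>\<^sup>2
           / norm x powr (p * a) \<partial>lborel) \<le> C * (\<integral>x. excess p a b u du x \<partial>lborel)"
proof -
  define \<sigma> \<alpha> \<kappa> where "\<sigma> = b - a + 1" and "\<alpha> = p * a" and "\<kappa> = p / \<sigma>"
  have \<sigma>: "0 < \<sigma>" "\<sigma> \<le> 1" using ab by (auto simp: \<sigma>_def)
  have \<kappa>: "0 < \<kappa>" using \<sigma> p by (simp add: \<kappa>_def)
  have \<alpha>: "0 \<le> \<alpha>" "\<alpha> < DIM('a)" using ab p pa by (auto simp: \<alpha>_def)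
  have \<alpha>\<sigma>: "1 - \<sigma> - \<alpha> \<le> 0" using ab p mult_right_mono[of 1 p a] by (simp add: \<alpha>_def \<sigma>_def)
  let ?w = "wt \<alpha> \<kappa> \<sigma>"
  obtain Cw R where Cw: "0 < Cw" and R: "0 < R" and weighted:
    "\<And>(F::'a \<Rightarrow> real) V B L. (\<And>x. GDERIV F x :> V x) \<Longrightarrow> continuous_on UNIV V \<Longrightarrow>
      (\<And>x. 0 \<le> F x \<and> F x \<le> B) \<Longrightarrow> (\<And>x. L < norm x \<Longrightarrow> V x = 0) \<Longrightarrow>
      integrable lborel (\<lambda>x. norm x powr (1 - \<sigma>) * ?w (norm x) * norm (V x)) \<and>
      (\<integral>x. F x * ?w (norm x) \<partial>lborel) \<le>
        Cw * ((\<integral>x. indicator (cbox (- R *\<^sub>R One) (R *\<^sub>R One)) x * F x \<partial>lborel)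
          + (\<integral>x. norm x powr (1 - \<sigma>) * ?w (norm x) * norm (V x) \<partial>lborel))"
  proof (rule weighted_L1_bound[OF dim \<sigma> \<kappa> \<alpha>], goal_cases)
    case (1 Cw R)
    show thesis by (rule 1(1)[OF 1(2-4)])
  qed
  define Q where "Q = (cbox (- R *\<^sub>R One) (R *\<^sub>R One) :: 'a set)"
  have Q_pos: "0 < measure lborel Q" using R by (auto simp: Q_def inner_simps intro!: prod_pos)
  obtain Cp where Cp: "0 < Cp" and poincare:
    "\<And>f V. (\<And>x. GDERIV f x :> V x) \<Longrightarrow> continuous_on UNIV V \<Longrightarrow>
      (\<integral>x. indicator Q x * f x \<partial>lborel) = 0 \<Longrightarrow>
      (\<integral>x. indicator Q x * \<bar>f x\<bar> \<partial>lborel) \<le> Cp * (\<integral>x. indicator Q x * norm (V x) \<partial>lborel)"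
  proof (rule L1_poincare_cbox[OF Q_def Q_pos], goal_cases)
    case (1 C)
    show thesis by (rule 1(1)[OF 1(2-3)])
  qed
  have "bounded Q" by (simp add: Q_def)
  then obtain R' where R': "0 < R'" "\<And>x. x \<in> Q \<Longrightarrow> norm x \<le> R'" by (auto simp: bounded_pos)
  \<comment> \<open>A lower bound of the gradient weight on Q: since 1 - \<sigma> = a - b \<le> p a,
    that weight decreases with the radius, and R' is a radius containing the cube.\<close>
  define q where "q = R' powr (1 - \<sigma> - \<alpha>) * exp (- \<kappa> * R' powr \<sigma>)"
  have q: "0 < q" using R' by (simp add: q_def)
  have q_le: "q \<le> norm x powr (1 - \<sigma>) * ?w (norm x)" if "x \<in> Q" "x \<noteq> 0" for x
  proof -
    have "q \<le> norm x powr (1 - \<sigma> - \<alpha>) * exp (- \<kappa> * norm x powr \<sigma>)"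
      unfolding q_def using that R' \<alpha>\<sigma> \<kappa> \<sigma> by (intro mult_mono powr_mono2') (auto intro!: powr_mono2)
    also have "norm x powr (1 - \<sigma> - \<alpha>) = norm x powr (1 - \<sigma>) * norm x powr - \<alpha>" by (simp flip: powr_add)
    finally show ?thesis by (simp add: wt_def mult_ac)
  qed
  define C2 where "C2 = Cw * (Cp / q + 1)"
  have C2: "0 < C2" using Cw Cp q by (simp add: C2_def add_pos_pos)
  \<comment> \<open>Chosen so that C2 * 2 * \<epsilon> = 1/2, which leaves half of X on the
    left.\<close>
  define \<epsilon> where "\<epsilon> = 1 / (4 * C2)"
  have \<epsilon>: "0 < \<epsilon>" using C2 by (simp add: \<epsilon>_def)
  define C3 where "C3 = 2 * C2 * (p * (3 + 1 / \<epsilon>))"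
  have C3: "0 < C3" using C2 p \<epsilon> by (simp add: C3_def add_pos_pos)
  show ?thesis
  \<comment> \<open>The factor 72 / p is 36 from \<open>half_pow_diff_square_le\<close> times 2 / p
    from \<open>orlicz_ge\<close>.\<close>
  proof (rule that[of "72 / p * C3"])
    show "0 < 72 / p * C3" using C3 p by simp
    fix u :: "'a \<Rightarrow> real" and du
    assume u: "punctured_test u du" and iE: "integrable lborel (excess p a b u du)"
    define g where "g = (\<lambda>x. u x * exp (norm x powr \<sigma> / \<sigma>))"
    define dg where "dg = (\<lambda>x. exp (norm x powr \<sigma> / \<sigma>) *\<^sub>R (du x + (u x * norm x powr (\<sigma> - 1)) *\<^sub>R sgn x))"
    have g: "punctured_test g dg"
      unfolding g_def dg_def using u \<sigma>(1) by (rule punctured_test_div_extremal)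
    obtain G where G: "\<And>x. \<bar>g x\<bar> \<le> G" using punctured_test_bounded[OF g] by metis
    have G0: "0 \<le> G" using G[of 0] by linarith
    obtain L where L: "\<And>x. L < norm x \<Longrightarrow> dg x = 0" using g unfolding punctured_test_def by metis
    obtain m where m: "(\<integral>x. indicator Q x * signed_orlicz p m (g x - m) \<partial>lborel) = 0"
      using exists_signed_orlicz_mean_zero[OF _ punctured_testD(3)[OF g] G, of p] p unfolding Q_def by (metis less_trans zero_less_one)
    define t where "t x = g x - m" for x
    define W where "W x = (m\<^sup>2 + (t x)\<^sup>2) powr (p / 2 - 1)" for x
    define F where "F x = orlicz p m (t x)" for x
    define z where "z x = norm x powr (1 - \<sigma>) * norm (dg x)" for x
    have dt: "GDERIV t x :> dg x" for x
      using GDERIV_diff[OF punctured_testD(1)[OF g] GDERIV_const[of m]] by (simp add: t_def[abs_def])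
    have F: "GDERIV F x :> (p * t x * W x) *\<^sub>R dg x" for x
      unfolding F_def W_def using p by (intro GDERIV_DERIV_compose[OF dt] DERIV_orlicz)
    \<comment> \<open>This gradient differs from that of F only by a sign, so both have the norm
      \<open>nV\<close>.\<close>
    have S: "GDERIV (\<lambda>x. signed_orlicz p m (t x)) x :> (p * \<bar>t x\<bar> * W x) *\<^sub>R dg x" for x
      unfolding W_def using p by (intro GDERIV_DERIV_compose[OF dt] DERIV_signed_orlicz)
    have contt: "continuous_on UNIV t" unfolding t_def by (intro continuous_intros punctured_testD[OF g])
    have contc: "continuous_on UNIV (\<lambda>x. t x * W x)"
      unfolding W_def by (rule continuous_on_orlicz_deriv[OF p(1) contt])
    then have cont1: "continuous_on UNIV (\<lambda>x. (p * t x * W x) *\<^sub>R dg x)"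
      unfolding mult.assoc by (intro continuous_on_scaleR continuous_on_mult_left punctured_testD[OF g])
    have "(\<lambda>x. (p * \<bar>t x\<bar> * W x) *\<^sub>R dg x) = (\<lambda>x. (p * \<bar>t x * W x\<bar>) *\<^sub>R dg x)"
      by (simp add: abs_mult W_def mult.assoc)
    then have cont2: "continuous_on UNIV (\<lambda>x. (p * \<bar>t x\<bar> * W x) *\<^sub>R dg x)"
      using contc by (simp only:)
        (intro continuous_on_scaleR continuous_on_mult_left continuous_on_rabs punctured_testD[OF g])
    have F0: "0 \<le> F x" for x using p by (simp add: F_def orlicz_nonneg)
    have FB: "0 \<le> F x \<and> F x \<le> (m\<^sup>2 + (G + \<bar>m\<bar>)\<^sup>2) powr (p / 2)" for x
    proof -
      have "\<bar>t x\<bar> \<le> G + \<bar>m\<bar>" using G[of x] by (simp add: t_def)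
      then have "(t x)\<^sup>2 \<le> (G + \<bar>m\<bar>)\<^sup>2" using G0 by (metis abs_le_square_iff abs_of_nonneg abs_ge_zero add_nonneg_nonneg)
      then have "(m\<^sup>2 + (t x)\<^sup>2) powr (p / 2) \<le> (m\<^sup>2 + (G + \<bar>m\<bar>)\<^sup>2) powr (p / 2)"
        using p by (intro powr_mono2) auto
      moreover have "F x \<le> (m\<^sup>2 + (t x)\<^sup>2) powr (p / 2)" by (simp add: F_def orlicz_def)
      ultimately show ?thesis using F0[of x] by linarith
    qed
    define nV where "nV x = p * \<bar>t x\<bar> * W x * norm (dg x)" for x
    have nV1: "norm ((p * t x * W x) *\<^sub>R dg x) = nV x" and nV2: "norm ((p * \<bar>t x\<bar> * W x) *\<^sub>R dg x) = nV x" for x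
      using p by (simp_all add: nV_def W_def abs_mult)
    define X Y E where "X = (\<integral>x. F x * ?w (norm x) \<partial>lborel)"
      and "Y = (\<integral>x. norm x powr (1 - \<sigma>) * ?w (norm x) * nV x \<partial>lborel)"
      and "E = (\<integral>x. excess p a b u du x \<partial>lborel)"
    have iY: "integrable lborel (\<lambda>x. norm x powr (1 - \<sigma>) * ?w (norm x) * nV x)"
      and XY: "X \<le> Cw * ((\<integral>x. indicator Q x * F x \<partial>lborel) + Y)"
      using weighted[OF F cont1 FB, of L] L unfolding nV1 X_def Y_def Q_def by auto
    have contnV: "continuous_on UNIV nV" using continuous_on_norm[OF cont1] unfolding nV1 .
    have [measurable]: "F \<in> borel_measurable borel"
      using F by (intro borel_measurable_continuous_onI continuous_at_imp_continuous_on ballI has_derivative_continuous)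
        (auto simp: gderiv_def)
    \<comment> \<open>F is bounded and the weight integrable; finiteness of X is what permits its
      absorption.\<close>
    have iX: "integrable lborel (\<lambda>x. F x * ?w (norm x))"
    proof (rule Bochner_Integration.integrable_bound[OF integrable_mult_right[OF integrable_wt(1)[OF \<kappa> \<sigma>(1) \<alpha>], of "(m\<^sup>2 + (G + \<bar>m\<bar>)\<^sup>2) powr (p / 2)"]])
      show "AE x in lborel. norm (F x * ?w (norm x)) \<le> norm ((m\<^sup>2 + (G + \<bar>m\<bar>)\<^sup>2) powr (p / 2) * ?w (norm x))"
        using FB by (intro AE_I2) (simp add: abs_mult mult_right_mono)
    qed simp
    have "(\<integral>x. indicator Q x * F x \<partial>lborel) \<le> Cp * (\<integral>x. indicator Q x * nV x \<partial>lborel)"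
      using poincare[OF S cont2] m p unfolding nV2 by (simp add: abs_signed_orlicz F_def t_def)
    also have "(\<integral>x. indicator Q x * nV x \<partial>lborel) \<le> (\<integral>x. 1 / q * (norm x powr (1 - \<sigma>) * ?w (norm x) * nV x) \<partial>lborel)"
    proof (rule integral_mono_AE)
      show "integrable lborel (\<lambda>x. indicator Q x * nV x)"
        using borel_integrable_compact[of Q nV] continuous_on_subset[OF contnV] by (auto simp: Q_def)
      have "indicator Q x * nV x \<le> 1 / q * (norm x powr (1 - \<sigma>) * ?w (norm x) * nV x)" if "x \<noteq> 0" for x
      proof (cases "x \<in> Q")
        case True
        have "q * nV x \<le> norm x powr (1 - \<sigma>) * ?w (norm x) * nV x"
          using p by (intro mult_right_mono q_le True that) (simp add: nV_def W_def)
        then show ?thesis using True q by (simp add: field_simps)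
      next
        case False
        then show ?thesis using p q by (simp add: nV_def W_def)
      qed
      then show "AE x in lborel. indicator Q x * nV x \<le> 1 / q * (norm x powr (1 - \<sigma>) * ?w (norm x) * nV x)"
        using AE_lborel_singleton[of "0::'a"] by auto
    qed (use iY in auto)
    also have "\<dots> = Y / q" by (simp add: Y_def)
    finally have "(\<integral>x. indicator Q x * F x \<partial>lborel) + Y \<le> (Cp / q + 1) * Y" using Cp by (simp add: distrib_right)
    from mult_left_mono[OF this less_imp_le[OF Cw]] XY
    have XY': "X \<le> C2 * Y" by (simp add: C2_def mult.assoc)
    \<comment> \<open>After \<open>orlicz_deriv_mult_le\<close>, the first term returns to F by
      \<open>orlicz_ge\<close> and the second is the remainder by \<open>excess_eq\<close>.\<close>
    have point: "norm x powr (1 - \<sigma>) * ?w (norm x) * nV x \<le> 2 * \<epsilon> * (F x * ?w (norm x)) + p * (3 + 1 / \<epsilon>) * excess p a b u du x" for x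
    proof -
      have Fge: "p * ((t x)\<^sup>2 * W x) \<le> 2 * F x" using orlicz_ge[OF p, of "t x" m] by (simp add: F_def W_def)
      have ex: "?w (norm x) * ((z x)\<^sup>2 * (\<bar>m + t x\<bar> + z x) powr (p - 2)) = excess p a b u du x"
        using excess_eq[OF \<sigma>_def \<sigma>(1), of p u du x] by (simp add: g_def t_def z_def dg_def \<alpha>_def \<kappa>_def)
      have "norm x powr (1 - \<sigma>) * ?w (norm x) * nV x = p * ?w (norm x) * (\<bar>t x\<bar> * W x * z x)"
        by (simp add: nV_def z_def)
      also have "\<dots> \<le> p * ?w (norm x) * (\<epsilon> * ((t x)\<^sup>2 * W x) + (3 + 1 / \<epsilon>) * ((z x)\<^sup>2 * (\<bar>m + t x\<bar> + z x) powr (p - 2)))"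
        unfolding W_def using p \<epsilon> by (intro mult_left_mono orlicz_deriv_mult_le) (auto simp: z_def)
      also have "\<dots> = \<epsilon> * ?w (norm x) * (p * ((t x)\<^sup>2 * W x)) + p * (3 + 1 / \<epsilon>) * excess p a b u du x"
        unfolding ex[symmetric] by (simp add: algebra_simps)
      also have "\<dots> \<le> \<epsilon> * ?w (norm x) * (2 * F x) + p * (3 + 1 / \<epsilon>) * excess p a b u du x"
        using \<epsilon> by (intro add_right_mono mult_left_mono Fge) auto
      finally show ?thesis by (simp add: mult_ac)
    qed
    have "Y \<le> (\<integral>x. 2 * \<epsilon> * (F x * ?w (norm x)) + p * (3 + 1 / \<epsilon>) * excess p a b u du x \<partial>lborel)"
      unfolding Y_def using iX iE by (intro integral_mono iY point) auto
    also have "\<dots> = 2 * \<epsilon> * X + p * (3 + 1 / \<epsilon>) * E" using iX iE by (simp add: X_def E_def)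
    finally have "C2 * Y \<le> C2 * (2 * \<epsilon> * X + p * (3 + 1 / \<epsilon>) * E)" using C2 by (intro mult_left_mono) auto
    also have "\<dots> = X / 2 + C3 * E / 2" using C2 by (simp add: \<epsilon>_def C3_def field_simps)
    finally have XE: "X \<le> C3 * E" using XY' by simp
    have half: "\<bar>half_pow p (u x) - half_pow p m * exp (- (p / 2 * norm x powr \<sigma> / \<sigma>))\<bar>\<^sup>2 / norm x powr (p * a)
      \<le> 72 / p * (F x * ?w (norm x))" for x
    proof -
      define s where "s = norm x powr \<sigma> / \<sigma>"
      \<comment> \<open>\<open>half_pow\<close> is homogeneous of degree p / 2, so U powr (p / 2)
        factors out of the difference; its square and |x| powr (- p a) combine to the
        weight.\<close>
      have ux: "u x = exp (- s) * (m + t x)" by (simp add: t_def g_def s_def exp_minus)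
      have e: "exp (- s) powr (p / 2) = exp (- (p / 2 * norm x powr \<sigma> / \<sigma>))"
        by (simp add: exp_powr_real s_def mult.commute)
      have "half_pow p (u x) = exp (- s) powr (p / 2) * half_pow p (m + t x)"
        unfolding ux by (rule half_pow_mult_pos) simp
      then have "half_pow p (u x) - half_pow p m * exp (- (p / 2 * norm x powr \<sigma> / \<sigma>))
        = exp (- s) powr (p / 2) * (half_pow p (m + t x) - half_pow p m)"
        unfolding e by (metis mult.commute right_diff_distrib)
      then have "\<bar>half_pow p (u x) - half_pow p m * exp (- (p / 2 * norm x powr \<sigma> / \<sigma>))\<bar>\<^sup>2 / norm x powr (p * a)
        = (exp (- s) powr (p / 2))\<^sup>2 * norm x powr - \<alpha> * \<bar>half_pow p (m + t x) - half_pow p m\<bar>\<^sup>2"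
        by (simp only: abs_mult power_mult_distrib power2_abs \<alpha>_def powr_minus divide_inverse mult_ac)
      also have "(exp (- s) powr (p / 2))\<^sup>2 * norm x powr - \<alpha> = ?w (norm x)"
        by (simp add: wt_def exp_powr_real s_def \<kappa>_def flip: exp_double)
      also have "?w (norm x) * \<bar>half_pow p (m + t x) - half_pow p m\<bar>\<^sup>2 \<le> ?w (norm x) * (36 * (2 / p * F x))"
      proof (rule mult_left_mono)
        have "(t x)\<^sup>2 * W x \<le> 2 / p * F x" using orlicz_ge[OF p, of "t x" m] p by (simp add: F_def W_def field_simps)
        then show "\<bar>half_pow p (m + t x) - half_pow p m\<bar>\<^sup>2 \<le> 36 * (2 / p * F x)"
          using half_pow_diff_square_le[OF p, of m "t x"] by (simp add: W_def)
      qed simp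
      finally show ?thesis by (simp add: mult_ac)
    qed
    have "(\<integral>x. \<bar>half_pow p (u x) - half_pow p m * exp (- (p / 2 * norm x powr \<sigma> / \<sigma>))\<bar>\<^sup>2 / norm x powr (p * a) \<partial>lborel)
      \<le> (\<integral>x. 72 / p * (F x * ?w (norm x)) \<partial>lborel)"
      using iX half F0 p by (intro integral_mono') auto
    also have "\<dots> = 72 / p * X" by (simp add: X_def)
    also have "\<dots> \<le> 72 / p * (C3 * E)" using XE p by (intro mult_left_mono) auto
    finally show "\<exists>c. (\<integral>x. \<bar>half_pow p (u x) - half_pow p c * exp (- (p / 2 * norm x powr (b - a + 1) / (b - a + 1)))\<bar>\<^sup>2
           / norm x powr (p * a) \<partial>lborel) \<le> 72 / p * C3 * (\<integral>x. excess p a b u du x \<partial>lborel)"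
      unfolding \<sigma>_def E_def by (auto simp: mult.assoc)
  qed
qed

subsection \<open>The deficit as a Bregman remainder\<close>

definition bregman_density :: "real \<Rightarrow> real \<Rightarrow> real \<Rightarrow> ('a::euclidean_space \<Rightarrow> real) \<Rightarrow> ('a \<Rightarrow> 'a) \<Rightarrow> 'a \<Rightarrow> real" where
  "bregman_density p a b u du x = norm (weighted_grad b du x) powr p + (p - 1) * norm (radial_term a u x) powr p
    + p * norm (radial_term a u x) powr (p - 2) * (radial_term a u x \<bullet> weighted_grad b du x)"

lemma excess_le_bregman_density:
  assumes "1 < p" "p < 2"
  shows "excess p a b u du x \<le> 4 / (p - 1) * bregman_density p a b u du x"
  using bregman_powr_vector[OF assms, of "weighted_grad b du x" "radial_term a u x"] assms
  by (simp add: excess_def bregman_density_def field_simps)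

text \<open>The cross term p |B| powr (p - 2) B \<bullet> A equals |x| powr (- k) times the inner
  product of x with the gradient of |u| powr p. The divergence theorem converts it into the third
  integral, with coefficient - (n - k) for dimension n.\<close>

lemma integral_bregman_density:
  fixes u :: "'a::euclidean_space \<Rightarrow> real" and p a b :: real
  assumes u: "punctured_test u du" and dim: "2 \<le> DIM('a)" and p: "1 < p" "p < 2"
  shows "integrable lborel (bregman_density p a b u du)"
    and "(\<integral>x. bregman_density p a b u du x \<partial>lborel) =
      (\<integral>x. norm (du x) powr p / norm x powr (p * b) \<partial>lborel)
      + (p - 1) * (\<integral>x. \<bar>u x\<bar> powr p / norm x powr (p * a) \<partial>lborel)
      - (DIM('a) - (p - 1) * a - b - 1)
        * (\<integral>x. \<bar>u x\<bar> powr p / norm x powr ((p - 1) * a + b + 1) \<partial>lborel)"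
proof -
  define k where "k = (p - 1) * a + b + 1"
  \<comment> \<open>This is |u| powr p, written so that the derivative and continuity facts for
    \<open>orlicz\<close> cover the zeros of u.\<close>
  define F where "F x = orlicz p 0 (u x)" for x
  define V where "V x = (p * (u x * (0\<^sup>2 + (u x)\<^sup>2) powr (p / 2 - 1))) *\<^sub>R du x" for x
  have F: "GDERIV F x :> V x" for x
    using GDERIV_DERIV_compose[OF punctured_testD(1)[OF u] DERIV_orlicz[OF p(1), of 0 "u x"]]
    by (simp add: F_def[abs_def] V_def mult.assoc)
  have F_eq: "F x = \<bar>u x\<bar> powr p" for x by (simp add: F_def orlicz_zero_left)
  have V: "continuous_on S V" for S
    unfolding V_def using p
    by (intro continuous_on_scaleR continuous_on_mult_left continuous_on_orlicz_deriv punctured_testD[OF u])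
  have contF: "continuous_on S F" for S
    unfolding F_def using p by (intro continuous_on_orlicz punctured_testD[OF u] continuous_intros) auto
  have F0: "F x = 0" if "u x = 0" for x using that by (simp add: F_def)
  have V0: "V x = 0" if "u x = 0" for x using that by (simp add: V_def)
  define I1 I2 I3 where "I1 x = norm (du x) powr p / norm x powr (p * b)"
    and "I2 x = \<bar>u x\<bar> powr p / norm x powr (p * a)" and "I3 x = \<bar>u x\<bar> powr p / norm x powr k" for x
  define J where "J x = norm x powr - k * (x \<bullet> V x)" for x
  have num: "continuous_on S (\<lambda>x. norm (du x) powr p)" "continuous_on S (\<lambda>x. \<bar>u x\<bar> powr p)" for S
    using p by (intro continuous_on_powr' continuous_on_norm continuous_on_rabs continuous_on_const punctured_testD[OF u]; auto)+
  have int: "integrable lborel I1" "integrable lborel I2" "integrable lborel I3"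
    unfolding I1_def I2_def I3_def
    by (rule integrable_punctured_test[OF u]; auto intro!: continuous_on_divide num continuous_intros)+
  note rad = radial_divergence_integral[OF dim F V, of "\<lambda>r. r powr - k" "\<lambda>r. - k * r powr (- k - 1)"]
  have prem: "0 < r \<Longrightarrow> ((\<lambda>r. r powr - k) has_real_derivative - k * r powr (- k - 1)) (at r)" for r :: real
    by (auto intro!: derivative_eq_intros)
  have prem': "continuous_on {0<..} (\<lambda>r::real. - k * r powr (- k - 1))" by (auto intro!: continuous_intros)
  have ints: "integrable lborel (\<lambda>x. norm x * (F x * norm x powr - k))"
    "integrable lborel (\<lambda>x. F x * norm x powr - k)"
    "integrable lborel (\<lambda>x. F x * (norm x * (- k * norm x powr (- k - 1))))"
    "integrable lborel (\<lambda>x. norm x * (norm x powr - k * norm (V x)))"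
    by (rule integrable_punctured_test[OF u]; auto intro!: continuous_intros contF V simp: F0 V0)+
  have J: "integrable lborel J" unfolding J_def by (rule rad(1)[OF prem prem' ints])
  have "(\<integral>x. (DIM('a) - k) * I3 x + J x \<partial>lborel) = 0"
  proof -
    have "F x * (DIM('a) * norm x powr - k + norm x * (- k * norm x powr (- k - 1))) + norm x powr - k * (x \<bullet> V x)
      = (DIM('a) - k) * I3 x + J x" for x
    proof (cases "x = 0")
      case True
      then show ?thesis using F0[of 0] punctured_testD(4)[OF u] by (simp add: I3_def J_def)
    next
      case False
      have "norm x * norm x powr (- k - 1) = norm x powr - k" using False by (simp add: powr_diff)
      then show ?thesis using False
        by (simp add: I3_def J_def F_eq powr_minus divide_inverse algebra_simps)
    qed
    then show ?thesis using rad(2)[OF prem prem' ints] by simp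
  qed
  then have JI: "(\<integral>x. J x \<partial>lborel) = - (DIM('a) - k) * (\<integral>x. I3 x \<partial>lborel)"
    using int J by (simp add: algebra_simps)
  have D: "bregman_density p a b u du = (\<lambda>x. I1 x + (p - 1) * I2 x + J x)"
  proof
    fix x
    show "bregman_density p a b u du x = I1 x + (p - 1) * I2 x + J x"
    proof (cases "x = 0")
      case True
      then show ?thesis using punctured_testD(4,5)[OF u]
        by (simp add: bregman_density_def weighted_grad_def radial_term_def I1_def I2_def J_def)
    next
      case False
      define r where "r = norm x"
      have r: "0 < r" using False by (simp add: r_def)
      have e: "(norm x powr - c) powr p = 1 / norm x powr (p * c)" for c
        by (simp only: powr_powr) (simp add: powr_minus_divide mult.commute)
      have A: "norm (weighted_grad b du x) powr p = I1 x"
        by (simp add: weighted_grad_def I1_def powr_mult e)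
      have B: "norm (radial_term a u x) = \<bar>u x\<bar> * r powr - a"
        using False by (simp add: radial_term_def norm_sgn abs_mult r_def)
      have B': "norm (radial_term a u x) powr p = I2 x"
        by (simp add: B I2_def powr_mult e r_def)
      have "- a * (p - 2) + (- a + (- b + - 1)) = - k" by (simp add: k_def algebra_simps)
      then have k: "r powr (- a * (p - 2)) * (r powr - a * (r powr - b * r powr - 1)) = r powr - k"
        by (simp only: powr_add[symmetric])
      have sgn: "sgn x \<bullet> du x = r powr - 1 * (x \<bullet> du x)"
        using r by (simp add: sgn_div_norm r_def powr_minus)
      have "norm (radial_term a u x) powr (p - 2) = \<bar>u x\<bar> powr (p - 2) * r powr (- a * (p - 2))"
        by (simp only: B powr_mult powr_powr)
      moreover have "radial_term a u x \<bullet> weighted_grad b du x = u x * r powr - a * (r powr - b * (r powr - 1 * (x \<bullet> du x)))"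
        by (simp only: radial_term_def weighted_grad_def inner_scaleR_left inner_scaleR_right sgn r_def[symmetric] mult_ac)
      ultimately have "norm (radial_term a u x) powr (p - 2) * (radial_term a u x \<bullet> weighted_grad b du x)
        = \<bar>u x\<bar> powr (p - 2) * u x * (r powr - k * (x \<bullet> du x))"
        by (simp only: k[symmetric] mult_ac)
      also have "\<bar>u x\<bar> powr (p - 2) = (0\<^sup>2 + (u x)\<^sup>2) powr (p / 2 - 1)"
        using square_powr_half[of "u x" "p - 2"] by (simp add: diff_divide_distrib)
      finally have "p * norm (radial_term a u x) powr (p - 2) * (radial_term a u x \<bullet> weighted_grad b du x) = J x"
        by (simp add: J_def V_def r_def mult_ac)
      then show ?thesis by (simp add: bregman_density_def A B')
    qed
  qed
  show "integrable lborel (bregman_density p a b u du)" unfolding D using int J by simp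
  have "(\<integral>x. bregman_density p a b u du x \<partial>lborel) = (\<integral>x. I1 x \<partial>lborel) + (p - 1) * (\<integral>x. I2 x \<partial>lborel)
    - (DIM('a) - k) * (\<integral>x. I3 x \<partial>lborel)"
    unfolding D using int J by (simp add: JI algebra_simps)
  then show "(\<integral>x. bregman_density p a b u du x \<partial>lborel) =
      (\<integral>x. norm (du x) powr p / norm x powr (p * b) \<partial>lborel)
      + (p - 1) * (\<integral>x. \<bar>u x\<bar> powr p / norm x powr (p * a) \<partial>lborel)
      - (DIM('a) - (p - 1) * a - b - 1)
        * (\<integral>x. \<bar>u x\<bar> powr p / norm x powr ((p - 1) * a + b + 1) \<partial>lborel)"
    by (simp add: I1_def I2_def I3_def k_def algebra_simps)
qed

lemma integrable_excess:
  fixes u :: "'a::euclidean_space \<Rightarrow> real"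
  assumes u: "punctured_test u du" and dim: "2 \<le> DIM('a)" and p: "1 < p" "p < 2"
  shows "integrable lborel (excess p a b u du)"
proof (rule Bochner_Integration.integrable_bound[OF integrable_mult_right[OF integral_bregman_density(1)[OF assms], of "4 / (p - 1)"]])
  have "continuous_on (- {0}) (weighted_grad b du)" "continuous_on (- {0}) (radial_term a u)"
    unfolding weighted_grad_def radial_term_def by (auto intro!: continuous_intros punctured_testD[OF u])
  note [measurable] = this[THEN continuous_punctured_measurable]
  show "excess p a b u du \<in> borel_measurable lborel"
    unfolding excess_def[abs_def] by measurable
  show "AE x in lborel. norm (excess p a b u du x) \<le> norm (4 / (p - 1) * bregman_density p a b u du x)"
    unfolding real_norm_def abs_of_nonneg[OF excess_nonneg]
    by (intro AE_I2 order_trans[OF excess_le_bregman_density[OF p] abs_ge_self])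
qed

section \<open>From coordinate derivatives to gradients\<close>

lemma GDERIV_grad:
  fixes f :: "real ^ 'n \<Rightarrow> real"
  assumes "f differentiable at x"
  shows "GDERIV f x :> grad f x"
proof -
  define f' where "f' = frechet_derivative f (at x)"
  have f': "(f has_derivative f') (at x)" using assms by (simp add: f'_def frechet_derivative_works)
  then have "linear f'" by (simp add: has_derivative_linear)
  have "f' = (\<lambda>h. h \<bullet> grad f x)"
  proof
    fix h
    have "f' h = f' (\<Sum>i\<in>UNIV. h $ i *\<^sub>R axis i 1)"
      using basis_expansion[of h] by (simp add: scalar_mult_eq_scaleR)
    also have "\<dots> = (\<Sum>i\<in>UNIV. h $ i * f' (axis i 1))"
      using \<open>linear f'\<close> by (simp add: linear_sum linear_cmul)
    finally show "f' h = h \<bullet> grad f x" by (simp add: inner_vec_def grad_def partial_deriv_def f'_def)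
  qed
  with f' show ?thesis by (simp add: gderiv_def)
qed

lemma punctured_test_Cc_infty:
  fixes u :: "real ^ 'n \<Rightarrow> real"
  assumes u: "u \<in> Cc_infty_punctured"
  shows "punctured_test u (grad u)"
proof -
  define S where "S = closure (support_on UNIV u)"
  have "Ck (Suc 0) u" and S: "compact S" "0 \<notin> S"
    using u unfolding Cc_infty_punctured_def smooth_def S_def by blast+
  then have "u differentiable_on UNIV" and pd: "\<And>i. continuous_on UNIV (partial_deriv i u)" by auto
  then have G: "GDERIV u x :> grad u x" for x by (intro GDERIV_grad) (simp add: differentiable_on_def)
  have zero: "u x = 0 \<and> grad u x = 0" if x: "x \<notin> S" for x
  proof -
    have z: "u y = 0" if "y \<in> - S" for y
      using that closure_subset[of "support_on UNIV u"] by (auto simp: S_def support_on_def)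
    \<comment> \<open>Off the support u vanishes on an open set, so uniqueness of the derivative
      forces the gradient to be 0.\<close>
    have "(u has_derivative (\<lambda>h. 0)) (at x)"
      by (rule has_derivative_transform_within_open[of "\<lambda>_. 0" _ _ _ "- S"])
        (use x z compact_imp_closed[OF S(1)] in auto)
    with G[of x] have "(\<lambda>h. h \<bullet> grad u x) = (\<lambda>h. 0)" unfolding gderiv_def by (rule has_derivative_unique)
    then have "grad u x \<bullet> grad u x = 0" by metis
    then show ?thesis using z x by simp
  qed
  have "continuous_on UNIV (grad u)"
    unfolding grad_def[abs_def] using pd by (intro continuous_on_vec_lambda)
  moreover have "open (- S)" "0 \<in> - S" using S by (auto intro: compact_imp_closed)
  then obtain \<epsilon> where "0 < \<epsilon>" "ball 0 \<epsilon> \<subseteq> - S" by (metis openE)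
  then have "\<exists>\<epsilon>>0. \<forall>x. norm x < \<epsilon> \<longrightarrow> u x = 0 \<and> grad u x = 0"
    using zero by (intro exI[of _ \<epsilon>]) (auto simp: subset_iff)
  moreover obtain L where "\<And>x. x \<in> S \<Longrightarrow> norm x \<le> L" using compact_imp_bounded[OF S(1)] by (auto simp: bounded_iff)
  then have "\<exists>L. \<forall>x. L < norm x \<longrightarrow> u x = 0 \<and> grad u x = 0"
    using zero by (intro exI[of _ L]) (metis not_le)
  ultimately show ?thesis unfolding punctured_test_def using G by (intro conjI allI) auto
qed

theorem theorem1p7:
  fixes N p a b :: real
  assumes "N = real CARD('n::finite)"
    and "CARD('n) > 2"
    and "1 < p" and "p < 2"
    and "0 \<le> b" and "b < (N - p) / p"
    and "a = N * b / (N - p)"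
  shows "\<exists>C>0. \<forall>u \<in> (Cc_infty_punctured :: (real ^ 'n \<Rightarrow> real) set).
    (\<integral>x. norm (grad u x) powr p / norm x powr (p * b) \<partial>lborel)
    + (p - 1) * (\<integral>x. \<bar>u x\<bar> powr p / norm x powr (p * a) \<partial>lborel)
    - (N - (p - 1) * a - b - 1)
        * (\<integral>x. \<bar>u x\<bar> powr p / norm x powr ((p - 1) * a + b + 1) \<partial>lborel)
    \<ge> C * (INF c::real. \<integral>x. \<bar>half_pow p (u x)
             - half_pow p c * exp (- (p / 2 * norm x powr (b - a + 1) / (b - a + 1)))\<bar>\<^sup>2
           / norm x powr (p * a) \<partial>lborel)"
proof -
  have N: "N = real DIM(real ^ 'n)" "2 < N" "2 \<le> DIM(real ^ 'n)" using assms(1,2) by auto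
  have p: "1 < p" "p < 2" and Np: "0 < N - p" using assms(3,4) N by auto
  \<comment> \<open>All three structural conditions come from this bound, as a - b = p b / (N - p)
    and p a = N p b / (N - p).\<close>
  have pb: "p * b < N - p" using assms(6) p by (simp add: field_simps)
  have aN: "a * (N - p) = N * b" using assms(7) Np by simp
  have "b \<le> a"
  proof -
    have "0 \<le> p * b" using assms(5) p by simp
    then have "b * (N - p) \<le> a * (N - p)" using aN by (simp add: algebra_simps)
    then show ?thesis using Np by (simp add: mult_le_cancel_right)
  qed
  moreover have "a < b + 1"
  proof -
    have "a * (N - p) < (b + 1) * (N - p)" using pb aN by (simp add: algebra_simps)
    then show ?thesis using Np by (simp add: mult_less_cancel_right)
  qed
  moreover have "p * a < N"
  proof -
    have "p * a * (N - p) = N * (p * b)" using aN by (simp only: mult.assoc mult.left_commute)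
    also have "\<dots> < N * (N - p)" using pb N by (intro mult_strict_left_mono) auto
    finally show ?thesis using Np by (simp add: mult_less_cancel_right)
  qed
  ultimately have bp: "b \<le> a" "a < b + 1" "p * a < DIM(real ^ 'n)" unfolding N(1) by blast+
  obtain K where K: "0 < K" and main:
    "\<And>(u :: real ^ 'n \<Rightarrow> real) du. punctured_test u du \<Longrightarrow> integrable lborel (excess p a b u du) \<Longrightarrow>
      \<exists>c. (\<integral>x. \<bar>half_pow p (u x) - half_pow p c * exp (- (p / 2 * norm x powr (b - a + 1) / (b - a + 1)))\<bar>\<^sup>2
           / norm x powr (p * a) \<partial>lborel) \<le> K * (\<integral>x. excess p a b u du x \<partial>lborel)"
  proof (rule weighted_bregman_poincare[OF N(3) p assms(5) bp], goal_cases)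
    case (1 K)
    show thesis by (rule 1(1)[OF 1(2-3)])
  qed
  \<comment> \<open>K times the factor 4 / (p - 1) of \<open>excess_le_bregman_density\<close>,
    inverted.\<close>
  define C where "C = (p - 1) / (4 * K)"
  have C: "0 < C" using p K by (simp add: C_def)
  show ?thesis
  proof (intro exI[of _ C] conjI ballI C)
    fix u :: "real ^ 'n \<Rightarrow> real" assume "u \<in> Cc_infty_punctured"
    then have u: "punctured_test u (grad u)" by (rule punctured_test_Cc_infty)
    note iE = integrable_excess[OF u N(3) p, of a b] and D = integral_bregman_density[OF u N(3) p, of a b]
    define h where "h c = (\<integral>x. \<bar>half_pow p (u x) - half_pow p c * exp (- (p / 2 * norm x powr (b - a + 1) / (b - a + 1)))\<bar>\<^sup>2
           / norm x powr (p * a) \<partial>lborel)" for c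
    obtain c where c: "h c \<le> K * (\<integral>x. excess p a b u (grad u) x \<partial>lborel)"
      using main[OF u iE] unfolding h_def by blast
    have "(INF c. h c) \<le> h c"
      \<comment> \<open>The infimum lies below each member because the family is bounded below by 0,
        the integrands being nonnegative.\<close>
      by (rule cINF_lower) (auto simp: h_def bdd_below_def intro!: exI[of _ 0] Bochner_Integration.integral_nonneg)
    also note c
    also have "(\<integral>x. excess p a b u (grad u) x \<partial>lborel) \<le> (\<integral>x. 4 / (p - 1) * bregman_density p a b u (grad u) x \<partial>lborel)"
      using D(1) by (intro integral_mono iE excess_le_bregman_density p) auto
    also have "\<dots> = 4 / (p - 1) * (\<integral>x. bregman_density p a b u (grad u) x \<partial>lborel)" by simp
    finally have "(INF c. h c) \<le> K * (4 / (p - 1) * (\<integral>x. bregman_density p a b u (grad u) x \<partial>lborel))"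
      using K by simp
    from mult_left_mono[OF this less_imp_le[OF C]]
    have "C * (INF c. h c) \<le> (\<integral>x. bregman_density p a b u (grad u) x \<partial>lborel)"
      using K p by (simp add: C_def)
    then show "C * (INF c::real. \<integral>x. \<bar>half_pow p (u x)
             - half_pow p c * exp (- (p / 2 * norm x powr (b - a + 1) / (b - a + 1)))\<bar>\<^sup>2
           / norm x powr (p * a) \<partial>lborel)
      \<le> (\<integral>x. norm (grad u x) powr p / norm x powr (p * b) \<partial>lborel)
    + (p - 1) * (\<integral>x. \<bar>u x\<bar> powr p / norm x powr (p * a) \<partial>lborel)
    - (N - (p - 1) * a - b - 1)
        * (\<integral>x. \<bar>u x\<bar> powr p / norm x powr ((p - 1) * a + b + 1) \<partial>lborel)"
      unfolding D(2) h_def N(1) .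
  qed
qed

end
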